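(* Let $t>0$ and let $\sigma^{(t)}_n$ be the $n$-th controlling measure of the Poisson–Dirichlet distribution $PD(t)$. Then $$\sigma^{(t)}_n=\sum_{r=1}^n\sum_{\pi\in\Pi(n,r)}\sigma^{(t)}_{n,r,\pi},$$ where for $\pi\in\Pi(n,r)$ with blocks $B_1,\dots,B_r$ (ordered arbitrarily), $\sigma^{(t)}_{n,r,\pi}$ is the pushforward under the map $y=(y_1,\dots,y_r)\mapsto x=(x_1,\dots,x_n)$, $x_j=y_i$ for $j\in B_i$, of the measure on $[0,1]^r$ $$t^r\prod_{i=1}^r y_i^{|B_i|-1}\,\Big(1-\sum_{i=1}^r y_i\Big)_+^{t-1}\,dy .$$
   Context: Let $\Delta$ be the set of sequences $\alpha_1\ge\alpha_2\ge\dots\ge0$ with $\sum\alpha_i\le1$, set $\gamma=1-\sum\alpha_i$, and regard $\Delta$ as the part of the Thoma simplex where all $\beta_i=0$. For a partition $\lambda$ of $n$ let $\tilde m_\lambda$ be the monomial symmetric function $m_\lambda$, written as a polynomial in power sums, with $p_1\mapsto1$ and $p_k\mapsto\sum_i\alpha_i^k$ ($k\ge2$). The Poisson–Dirichlet distribution $PD(t)$ is the unique Borel probability measure on $\Delta$ with $\int_\Delta\tilde m_\lambda\,dPD(t)=M^{(t)}(\lambda)/\dim_0\lambda$ for all partitions $\lambda$, where $\dim_0\lambda=n!/\prod_i\lambda_i!$, $M^{(t)}(\lambda)=\frac{t^{\ell(\lambda)}n!}{(t)_n z_\lambda}$, $\ell(\lambda)$ is the number of nonzero parts, $z_\lambda=\prod_k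 k^{r_k}r_k!$ with $r_k$ the multiplicity of $k$ in $\lambda$, and $(t)_n=t(t+1)\cdots(t+n-1)$ (this is the usual ranked Poisson–Dirichlet law). Thoma measure: $\nu^{(\alpha)}=\sum_i\alpha_i\delta(\alpha_i)+\gamma\delta(0)$; the $n$-th controlling measure is $\sigma_n^{(t)}=\int(\nu^{(\alpha)})^{\otimes n}PD(t)(d\alpha)$, a measure on $[0,1]^n$. $\Pi(n,r)$ is the set of partitions of the set $\{1,\dots,n\}$ into $r$ nonempty blocks. *)

theory Defs
  imports "HOL-Probability.Probability" "HOL-Library.Disjoint_Sets"
begin

text \<open>The part Delta of the Thoma simplex with all beta_i = 0.\<close>
definition Delta :: "(nat \<Rightarrow> real) set" where
  "Delta = {\<alpha>. (\<forall>i. 0 \<le> \<alpha> i) \<and> (\<forall>i. \<alpha> (Suc i) \<le> \<alpha> i) \<and> summable \<alpha> \<and> suminf \<alpha> \<le> 1}"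

definition gamma_Thoma :: "(nat \<Rightarrow> real) \<Rightarrow> real" where
  "gamma_Thoma \<alpha> = 1 - suminf \<alpha>"

definition is_partition :: "nat list \<Rightarrow> bool" where
  "is_partition lam \<longleftrightarrow> sorted_wrt (\<ge>) lam \<and> (\<forall>k\<in>set lam. 0 < k)"

definition ptilde :: "nat \<Rightarrow> (nat \<Rightarrow> real) \<Rightarrow> real" where
  "ptilde k \<alpha> = (if k = 1 then 1 else (\<Sum>i. \<alpha> i ^ k))"

text \<open>Monomial symmetric function m_lam written as a polynomial in the power sums
  (m_lam = (1/prod_k r_k!) sum over set partitions P of the parts, with Moebius
  coefficients prod_B (-1)^(|B|-1) (|B|-1)!, of prod_B p_(sum of parts in B)),
  with the substitution p_1 -> 1, p_k -> sum alpha_i^k.\<close>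
definition mtilde :: "nat list \<Rightarrow> (nat \<Rightarrow> real) \<Rightarrow> real" where
  "mtilde lam \<alpha> =
     (1 / (\<Prod>k\<in>set lam. fact (count_list lam k))) *
     (\<Sum>P\<in>{P. partition_on {0..<length lam} P}.
        \<Prod>B\<in>P. (-1) ^ (card B - 1) * fact (card B - 1) * ptilde (\<Sum>i\<in>B. lam ! i) \<alpha>)"

definition dim0 :: "nat list \<Rightarrow> real" where
  "dim0 lam = fact (sum_list lam) / (\<Prod>i<length lam. fact (lam ! i))"

definition z_part :: "nat list \<Rightarrow> real" where
  "z_part lam = (\<Prod>k\<in>set lam. real k ^ count_list lam k * fact (count_list lam k))"

definition M_t :: "real \<Rightarrow> nat list \<Rightarrow> real" where
  "M_t t lam = t ^ length lam * fact (sum_list lam) / (pochhammer t (sum_list lam) * z_part lam)"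

definition thoma_measure :: "(nat \<Rightarrow> real) \<Rightarrow> real measure" where
  "thoma_measure \<alpha> = measure_of UNIV (sets borel)
     (\<lambda>A. (\<Sum>i. ennreal (\<alpha> i) * indicator A (\<alpha> i)) + ennreal (gamma_Thoma \<alpha>) * indicator A 0)"

definition controlling_measure :: "(nat \<Rightarrow> real) measure \<Rightarrow> nat \<Rightarrow> (nat \<Rightarrow> real) measure" where
  "controlling_measure M n =
     measure_of (space (PiM {0..<n} (\<lambda>_. borel :: real measure)))
                (sets (PiM {0..<n} (\<lambda>_. borel :: real measure)))
                (\<lambda>A. \<integral>\<^sup>+ \<alpha>. emeasure (PiM {0..<n} (\<lambda>_. thoma_measure \<alpha>)) A \<partial>M)"

definition set_partitions :: "nat \<Rightarrow> nat \<Rightarrow> nat set set set" where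
  "set_partitions n r = {P. partition_on {0..<n} P \<and> card P = r}"

definition block_density :: "real \<Rightarrow> nat set set \<Rightarrow> (nat set \<Rightarrow> real) \<Rightarrow> ennreal" where
  "block_density t P y =
     ennreal (t ^ card P * (\<Prod>B\<in>P. y B ^ (card B - 1)) * (max 0 (1 - (\<Sum>B\<in>P. y B))) powr (t - 1))
     * indicator (PiE P (\<lambda>_. {0..1})) y"

definition block_embed :: "nat \<Rightarrow> nat set set \<Rightarrow> (nat set \<Rightarrow> real) \<Rightarrow> (nat \<Rightarrow> real)" where
  "block_embed n P y = (\<lambda>j\<in>{0..<n}. y (THE B. B \<in> P \<and> j \<in> B))"

definition sigma_block :: "real \<Rightarrow> nat \<Rightarrow> nat set set \<Rightarrow> (nat \<Rightarrow> real) measure" where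
  "sigma_block t n P =
     distr (density (PiM P (\<lambda>_. lborel)) (block_density t P))
           (PiM {0..<n} (\<lambda>_. borel :: real measure)) (block_embed n P)"

end

theory Submission
  imports Defs
begin

text \<open>Both sides are finite measures on the cube \<open>[0,1]\<^sup>n\<close>, so it suffices to compare the moments
  \<open>\<integral> \<Prod>\<^sub>j x\<^sub>j^k\<^sub>j\<close>. Since \<open>\<integral> x^k\<close> against the Thoma measure is \<open>p\<^bsub>k+1\<^esub>\<close> (with \<open>p\<^sub>1 = 1\<close>), the moment of the
  controlling measure is the \<open>PD\<close>-integral of \<open>\<Prod>\<^sub>j p\<^bsub>k_j+1\<^esub>\<close>. Expanding this product in augmented
  monomial functions gives a sum over set partitions \<open>\<pi>\<close> of \<open>{0..<n}\<close>, and by the moment hypothesis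
  the summand of \<open>\<pi>\<close> is \<open>t^r \<Prod>\<^sub>B (s\<^sub>B - 1)! / (t)\<^sub>N\<close>, where \<open>s\<^sub>B = \<Sum>\<^bsub>j\<in>B\<^esub> (k\<^sub>j + 1)\<close> and
  \<open>N = \<Sum>\<^sub>B s\<^sub>B\<close>. Dirichlet's integral shows that this is the moment of the block measure of \<open>\<pi>\<close>.\<close>

section \<open>Products of power sums and augmented monomial functions\<close>

text \<open>When gamma > 0, the substitution p_1 -> 1 is not evaluation of the power sums at alpha,
  so the expansion into augmented monomial functions cannot be read off from sums over distinct
  indices. It is proved instead as an identity valid for every function \<open>p\<close>, by
  induction on the index set. This is why \<open>aug_mono\<close> takes \<open>p\<close> as a
  parameter and is indexed by an arbitrary finite set, which may itself be a set of blocks. The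
  augmented functions fit the moment hypothesis because they drop the symmetry factor of m_lambda:
  what remains of the given value is a product over the parts, apart from a Pochhammer symbol that
  depends only on the total weight. Merging parts into blocks preserves the total weight, so all set
  partitions share the same denominator.\<close>

lemma sum_partition_on_insert:
  fixes F :: "'a set set \<Rightarrow> 'b::comm_monoid_add"
  assumes fin: "finite I" and i: "i \<notin> I"
  shows "(\<Sum>P | partition_on (insert i I) P. F P) =
    (\<Sum>P | partition_on I P. F (insert {i} P) + (\<Sum>B\<in>P. F (insert (insert i B) (P - {B}))))"
proof -
  define S where "S = {P. partition_on I P}"
  \<comment> \<open>Pairs of a partition of \<open>I\<close> and one marked block, the block that
    \<open>i\<close> is going to join. The other new partitions, those with \<open>{i}\<close> as a
    block, come from \<open>S\<close> through \<open>f1\<close>.\<close>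
  define T where "T = Sigma S (\<lambda>P. P)"
  define f1 where "f1 = (\<lambda>P. insert {i} P)"
  define f2 where "f2 = (\<lambda>(P, B). insert (insert i B) (P - {B}))"
  have finS: "finite S" unfolding S_def by (rule finitely_many_partition_on[OF fin])
  have finP: "finite P" if "P \<in> S" for P using that fin by (auto simp: S_def intro: finite_elements)
  have ni: "i \<notin> B" if "P \<in> S" "B \<in> P" for P B
    using that i by (auto simp: S_def partition_on_def)
  have inj1: "inj_on f1 S"
  proof (rule inj_on_inverseI)
    fix P assume "P \<in> S"
    then have "{i} \<notin> P" using ni by blast
    then show "(\<lambda>Q. Q - {{i}}) (f1 P) = P" by (simp add: f1_def)
  qed
  \<comment> \<open>Inverse of \<open>f2\<close>: find the block containing \<open>i\<close>, take
    \<open>i\<close> out of it, and mark what is left.\<close>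
  define g where "g = (\<lambda>Q. let C = (THE C. C \<in> Q \<and> i \<in> C) in (insert (C - {i}) (Q - {C}), C - {i}))"
  have inj2: "inj_on f2 T"
  proof (rule inj_on_inverseI)
    fix PB assume "PB \<in> T"
    then obtain P B where PB: "PB = (P, B)" "P \<in> S" "B \<in> P" by (auto simp: T_def)
    have "(THE C. C \<in> f2 PB \<and> i \<in> C) = insert i B"
      using ni[OF PB(2)] by (intro the_equality) (auto simp: f2_def PB)
    moreover have "insert i B \<notin> P - {B}" using ni[OF PB(2)] by blast
    ultimately show "g (f2 PB) = PB"
      using ni[OF PB(2,3)] PB by (auto simp: g_def Let_def f2_def)
  qed
  have disj: "f1 ` S \<inter> f2 ` T = {}"
  proof -
    have "{i} \<notin> f2 (P, B)" if "P \<in> S" "B \<in> P" for P B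
    proof -
      have "B \<noteq> {}" using that by (auto simp: S_def partition_on_def)
      then show ?thesis using ni[OF that(1)] that(2) by (force simp: f2_def)
    qed
    then show ?thesis by (force simp: f1_def T_def)
  qed
  have part1: "f1 P \<in> {P. partition_on (insert i I) P}" if "P \<in> S" for P
    using that i by (auto simp: S_def f1_def partition_on_def disjoint_def)
  have part2: "f2 (P, B) \<in> {P. partition_on (insert i I) P}" if "P \<in> S" "B \<in> P" for P B
  proof -
    have "partition_on I P" using that by (simp add: S_def)
    then have U: "\<Union>P = I" and D: "\<And>X Y. X \<in> P \<Longrightarrow> Y \<in> P \<Longrightarrow> X \<noteq> Y \<Longrightarrow> X \<inter> Y = {}" and E: "{} \<notin> P"
      by (auto simp: partition_on_def disjoint_def)
    show ?thesis
      unfolding mem_Collect_eq f2_def prod.case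
    proof (rule partition_onI)
      show "\<Union> (insert (insert i B) (P - {B})) = insert i I" using U that(2) by blast
      show "{} \<notin> insert (insert i B) (P - {B})" using E by auto
      fix p q assume "p \<in> insert (insert i B) (P - {B})" "q \<in> insert (insert i B) (P - {B})" "p \<noteq> q"
      then show "disjnt p q"
        using D[of B q] D[of B p] D[of p q] ni[OF that(1)] that(2) by (auto simp: disjnt_def)
    qed
  qed
  have cover: "Q \<in> f1 ` S \<union> f2 ` T" if Q: "partition_on (insert i I) Q" for Q
  proof -
    have U: "\<Union>Q = insert i I" and D: "\<And>X Y. X \<in> Q \<Longrightarrow> Y \<in> Q \<Longrightarrow> X \<noteq> Y \<Longrightarrow> X \<inter> Y = {}" and E: "{} \<notin> Q"
      using Q by (auto simp: partition_on_def disjoint_def)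
    obtain C where C: "C \<in> Q" "i \<in> C" using U by blast
    have U': "\<Union> (Q - {C}) = insert i I - C"
      unfolding U[symmetric] using D[OF _ C(1)] C(1) by blast
    have CI: "C \<subseteq> insert i I" using U C(1) by blast
    show ?thesis
    proof (cases "C = {i}")
      case True
      have "partition_on I (Q - {C})"
      proof (rule partition_onI)
        show "\<Union> (Q - {C}) = I" unfolding U' using True i by auto
        show "{} \<notin> Q - {C}" using E by auto
        show "\<And>p q. p \<in> Q - {C} \<Longrightarrow> q \<in> Q - {C} \<Longrightarrow> p \<noteq> q \<Longrightarrow> disjnt p q"
          using D by (auto simp: disjnt_def)
      qed
      moreover have "Q = f1 (Q - {C})" using C True by (auto simp: f1_def)
      ultimately show ?thesis by (auto simp: S_def)
    next
      case False
      define P where "P = insert (C - {i}) (Q - {C})"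
      \<comment> \<open>A second block equal to \<open>C - {i}\<close> would meet \<open>C\<close>
        in a nonempty set. Ruling it out ensures that removing \<open>C - {i}\<close> from
        \<open>P\<close> loses no block of \<open>Q\<close>.\<close>
      have nQ: "C - {i} \<notin> Q - {C}"
        using D[of "C - {i}" C] C E False by auto
      have "partition_on I P"
        unfolding P_def
      proof (rule partition_onI)
        show "\<Union> (insert (C - {i}) (Q - {C})) = I"
          using U' CI C(2) i by auto
        show "{} \<notin> insert (C - {i}) (Q - {C})" using E False C by auto
        fix p q assume "p \<in> insert (C - {i}) (Q - {C})" "q \<in> insert (C - {i}) (Q - {C})" "p \<noteq> q"
        then show "disjnt p q" using D[of p q] D[of C q] D[of C p] C by (auto simp: disjnt_def)
      qed
      moreover have "Q = f2 (P, C - {i})"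
      proof -
        have "insert i (C - {i}) = C" "P - {C - {i}} = Q - {C}"
          using C nQ by (auto simp: P_def)
        then show ?thesis using C by (simp add: f2_def insert_absorb)
      qed
      ultimately show ?thesis unfolding T_def S_def P_def by blast
    qed
  qed
  have eq: "{P. partition_on (insert i I) P} = f1 ` S \<union> f2 ` T"
  proof (intro equalityI subsetI)
    fix Q assume "Q \<in> f1 ` S \<union> f2 ` T"
    then show "Q \<in> {P. partition_on (insert i I) P}"
      unfolding T_def using part1 part2 by blast
  qed (use cover in blast)
  have finT: "finite T" unfolding T_def using finS finP by auto
  have "(\<Sum>P | partition_on (insert i I) P. F P) = (\<Sum>P\<in>f1 ` S. F P) + (\<Sum>P\<in>f2 ` T. F P)"
    unfolding eq by (rule sum.union_disjoint) (use finS finT disj in auto)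
  also have "\<dots> = (\<Sum>P\<in>S. F (f1 P)) + (\<Sum>PB\<in>T. F (f2 PB))"
    by (simp add: sum.reindex inj1 inj2)
  also have "(\<Sum>PB\<in>T. F (f2 PB)) = (\<Sum>P\<in>S. \<Sum>B\<in>P. F (f2 (P, B)))"
    unfolding T_def using finS finP by (subst sum.Sigma) auto
  finally show ?thesis by (simp add: sum.distrib f1_def f2_def S_def)
qed

text \<open>The augmented monomial symmetric function of the parts \<open>w i\<close> in terms of the power sums \<open>p\<close>;
  the coefficients are the values of the Moebius function of the partition lattice.\<close>
definition aug_mono :: "(nat \<Rightarrow> real) \<Rightarrow> 'a set \<Rightarrow> ('a \<Rightarrow> nat) \<Rightarrow> real" where
  "aug_mono p I w = (\<Sum>P | partition_on I P.
     \<Prod>B\<in>P. (-1) ^ (card B - 1) * fact (card B - 1) * p (\<Sum>i\<in>B. w i))"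

lemma aug_mono_empty [simp]: "aug_mono p {} w = 1"
  by (simp add: aug_mono_def partition_on_empty)

lemma aug_mono_cong:
  assumes "\<And>i. i \<in> I \<Longrightarrow> w i = w' i"
  shows "aug_mono p I w = aug_mono p I w'"
  unfolding aug_mono_def
proof (intro sum.cong prod.cong refl)
  fix P B assume "P \<in> {P. partition_on I P}" "B \<in> P"
  then have "B \<subseteq> I" by (auto simp: partition_on_def)
  then have "(\<Sum>i\<in>B. w i) = (\<Sum>i\<in>B. w' i)" using assms by (intro sum.cong) auto
  then show "(-1) ^ (card B - 1) * fact (card B - 1) * p (\<Sum>i\<in>B. w i) =
      (-1) ^ (card B - 1) * fact (card B - 1) * p (\<Sum>i\<in>B. w' i)" by simp
qed

text \<open>Letting \<open>i\<close> join a block \<open>B\<close> multiplies the coefficient by \<open>- card B\<close>; this factor is spread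
  over the elements \<open>j \<in> B\<close>, the part \<open>w j\<close> absorbing \<open>w i\<close>.\<close>

lemma aug_mono_insert:
  assumes fin: "finite I" and i: "i \<notin> I"
  shows "aug_mono p (insert i I) w =
    p (w i) * aug_mono p I w - (\<Sum>j\<in>I. aug_mono p I (w(j := w j + w i)))"
proof -
  define c where "c = (\<lambda>(w :: 'a \<Rightarrow> nat) B. (-1) ^ (card B - 1) * fact (card B - 1) * p (\<Sum>i\<in>B. w i))"
  have A: "aug_mono p J w = (\<Sum>P | partition_on J P. \<Prod>B\<in>P. c w B)" for J w
    by (simp add: aug_mono_def c_def)
  have step: "(\<Prod>B\<in>insert {i} P. c w B) + (\<Sum>B\<in>P. \<Prod>C\<in>insert (insert i B) (P - {B}). c w C)
      = p (w i) * (\<Prod>B\<in>P. c w B) - (\<Sum>j\<in>I. \<Prod>B\<in>P. c (w(j := w j + w i)) B)"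
    if P: "partition_on I P" for P
  proof -
    have finP: "finite P" using P fin by (rule finite_elements[rotated])
    have sub: "B \<subseteq> I" if "B \<in> P" for B using P that by (auto simp: partition_on_def)
    have disj: "\<And>B C. B \<in> P \<Longrightarrow> C \<in> P \<Longrightarrow> B \<noteq> C \<Longrightarrow> B \<inter> C = {}"
      using P by (auto simp: partition_on_def disjoint_def)
    have one: "(\<Prod>B\<in>insert {i} P. c w B) = p (w i) * (\<Prod>B\<in>P. c w B)"
    proof -
      have "{i} \<notin> P" using sub i by blast
      then show ?thesis using finP by (simp add: c_def)
    qed
    have two: "(\<Prod>C\<in>insert (insert i B) (P - {B}). c w C)
        = - (\<Sum>j\<in>B. \<Prod>C\<in>P. c (w(j := w j + w i)) C)" if B: "B \<in> P" for B
    proof -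
      have finB: "finite B" and iB: "i \<notin> B" using sub[OF B] fin i finite_subset by auto
      have "card B \<noteq> 0" using finB B P by (auto simp: partition_on_def)
      then obtain m where m: "card B = Suc m" by (cases "card B") auto
      have other: "c (w(j := w j + w i)) C = c w C" if "C \<in> P - {B}" "j \<in> B" for C j
      proof -
        have "j \<notin> C" using that disj[of B C] B by auto
        then have "(\<Sum>k\<in>C. (w(j := w j + w i)) k) = (\<Sum>k\<in>C. w k)" by (intro sum.cong) auto
        then show ?thesis by (simp only: c_def)
      qed
      have same: "c (w(j := w j + w i)) B = (-1) ^ m * fact m * p (w i + (\<Sum>k\<in>B. w k))" if "j \<in> B" for j
      proof -
        have "(\<Sum>k\<in>B. (w(j := w j + w i)) k) = w j + w i + (\<Sum>k\<in>B - {j}. (w(j := w j + w i)) k)"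
          using finB that by (subst sum.remove[of _ j]) auto
        also have "(\<Sum>k\<in>B - {j}. (w(j := w j + w i)) k) = (\<Sum>k\<in>B - {j}. w k)"
          by (intro sum.cong) auto
        also have "w j + w i + \<dots> = w i + (\<Sum>k\<in>B. w k)"
          using finB that by (subst (2) sum.remove[of _ j]) auto
        finally show ?thesis by (simp only: c_def m diff_Suc_1)
      qed
      have "insert i B \<notin> P" using sub i by blast
      then have "(\<Prod>C\<in>insert (insert i B) (P - {B}). c w C)
          = c w (insert i B) * (\<Prod>C\<in>P - {B}. c w C)"
        using finP by simp
      also have "c w (insert i B) = - (real (card B) * ((-1) ^ m * fact m * p (w i + (\<Sum>k\<in>B. w k))))"
        using finB iB m by (simp add: c_def)
      finally have L: "(\<Prod>C\<in>insert (insert i B) (P - {B}). c w C) =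
         - (real (card B) * ((-1) ^ m * fact m * p (w i + (\<Sum>k\<in>B. w k)))) * (\<Prod>C\<in>P - {B}. c w C)" .
      have "(\<Prod>C\<in>P. c (w(j := w j + w i)) C) =
          ((-1) ^ m * fact m * p (w i + (\<Sum>k\<in>B. w k))) * (\<Prod>C\<in>P - {B}. c w C)" if j: "j \<in> B" for j
        using finP B other[OF _ j] same[OF j] by (subst prod.remove[of _ B]) (auto intro: prod.cong)
      then show ?thesis unfolding L by simp
    qed
    have "(\<Sum>j\<in>I. \<Prod>B\<in>P. c (w(j := w j + w i)) B) =
        (\<Sum>B\<in>P. \<Sum>j\<in>B. \<Prod>C\<in>P. c (w(j := w j + w i)) C)"
    proof -
      have "I = \<Union>P" using P by (auto simp: partition_on_def)
      moreover have "\<forall>B\<in>P. finite B" using sub fin finite_subset by blast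
      ultimately show ?thesis using disj
        by (simp only:) (subst sum.Union_disjoint, auto)
    qed
    then show ?thesis using one two by (simp add: sum_negf)
  qed
  have "aug_mono p (insert i I) w = (\<Sum>P | partition_on I P.
     p (w i) * (\<Prod>B\<in>P. c w B) - (\<Sum>j\<in>I. \<Prod>B\<in>P. c (w(j := w j + w i)) B))"
    unfolding A sum_partition_on_insert[OF fin i] using step by (intro sum.cong) auto
  also have "\<dots> = p (w i) * aug_mono p I w - (\<Sum>j\<in>I. aug_mono p I (w(j := w j + w i)))"
    unfolding A sum_subtractf sum_distrib_left by (subst (2) sum.swap) simp
  finally show ?thesis .
qed

text \<open>Relabelling invariance, obtained from the recursion \<open>aug_mono_insert\<close>
  instead of transporting set partitions along \<open>f\<close>. The weights stay arbitrary in the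
  induction because the recursion changes them.\<close>

lemma aug_mono_image:
  assumes "finite I" "inj_on f I"
  shows "aug_mono p (f ` I) w = aug_mono p I (w \<circ> f)"
  using assms
proof (induction I arbitrary: w rule: finite_induct)
  case (insert i I)
  have inj: "inj_on f I" and ni: "f i \<notin> f ` I" using insert by auto
  have "aug_mono p (f ` I) (w(f j := w (f j) + w (f i))) =
      aug_mono p I ((w \<circ> f)(j := (w \<circ> f) j + (w \<circ> f) i))" if "j \<in> I" for j
  proof -
    have "aug_mono p (f ` I) (w(f j := w (f j) + w (f i))) = aug_mono p I (w(f j := w (f j) + w (f i)) \<circ> f)"
      using insert.IH inj by blast
    also have "\<dots> = aug_mono p I ((w \<circ> f)(j := (w \<circ> f) j + (w \<circ> f) i))"
      using inj that by (intro aug_mono_cong) (auto simp: inj_on_def)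
    finally show ?thesis .
  qed
  then have "(\<Sum>j\<in>f ` I. aug_mono p (f ` I) (w(j := w j + w (f i)))) =
      (\<Sum>j\<in>I. aug_mono p I ((w \<circ> f)(j := (w \<circ> f) j + (w \<circ> f) i)))"
    using inj by (simp add: sum.reindex del: fun_upd_apply)
  moreover have "aug_mono p (f ` I) w = aug_mono p I (w \<circ> f)"
    using insert.IH inj by blast
  ultimately show ?case
    using insert.hyps ni by (simp add: aug_mono_insert o_def)
qed simp

text \<open>In the induction step, the partitions where \<open>i\<close> joins a block cancel against the subtracted
  sum of \<open>aug_mono_insert\<close>.\<close>

lemma sum_aug_mono_partition:
  assumes "finite I"
  shows "(\<Sum>P | partition_on I P. aug_mono p P (\<lambda>B. \<Sum>i\<in>B. w i)) = (\<Prod>i\<in>I. p (w i))"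
  using assms
proof (induction I rule: finite_induct)
  case empty
  then show ?case by (simp add: partition_on_empty)
next
  case (insert i I)
  define W where "W = (\<lambda>B. \<Sum>i\<in>B. w i)"
  have step: "aug_mono p (insert {i} P) W + (\<Sum>B\<in>P. aug_mono p (insert (insert i B) (P - {B})) W)
     = p (w i) * aug_mono p P W" if P: "partition_on I P" for P
  proof -
    have finP: "finite P" using P insert(1) by (rule finite_elements[rotated])
    have sub: "B \<subseteq> I" if "B \<in> P" for B using P that by (auto simp: partition_on_def)
    have "aug_mono p (insert (insert i B) (P - {B})) W = aug_mono p P (W(B := W B + w i))"
      if B: "B \<in> P" for B
    proof -
      \<comment> \<open>Replacing the block \<open>B\<close> by \<open>insert i B\<close> is a mere
        renaming of one index, after which this index carries the weight
        \<open>W B + w i\<close>.\<close>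
      define f where "f = (\<lambda>C. if C = B then insert i B else C)"
      have nP: "insert i B \<notin> P" using sub insert(2) by blast
      have inj: "inj_on f P" using nP by (auto simp: inj_on_def f_def)
      have "insert (insert i B) (P - {B}) = f ` P" using B by (auto simp: f_def)
      then have "aug_mono p (insert (insert i B) (P - {B})) W = aug_mono p P (W \<circ> f)"
        using aug_mono_image[OF finP inj] by simp
      also have "\<dots> = aug_mono p P (W(B := W B + w i))"
      proof (intro aug_mono_cong)
        have "finite B" "i \<notin> B" using sub[OF B] insert(1,2) finite_subset by auto
        then show "(W \<circ> f) C = (W(B := W B + w i)) C" for C
          by (auto simp: f_def W_def)
      qed
      finally show ?thesis .
    qed
    moreover have "{i} \<notin> P" using sub insert(2) by blast
    ultimately show ?thesis
      using finP by (simp add: aug_mono_insert W_def)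
  qed
  have "(\<Sum>P | partition_on (insert i I) P. aug_mono p P W) =
      (\<Sum>P | partition_on I P. p (w i) * aug_mono p P W)"
    unfolding sum_partition_on_insert[OF insert(1,2)] using step by (intro sum.cong) auto
  also have "\<dots> = (\<Prod>i\<in>insert i I. p (w i))"
    using insert by (simp add: W_def flip: sum_distrib_left)
  finally show ?case by (simp add: W_def)
qed

section \<open>Integrals of monomial functions\<close>

lemma prod_nth_eq_prod_count:
  fixes f :: "nat \<Rightarrow> real"
  shows "(\<Prod>i<length xs. f (xs ! i)) = (\<Prod>k\<in>set xs. f k ^ count_list xs k)"
proof -
  have "(\<Prod>i<length xs. f (xs ! i)) = prod_mset (image_mset f (mset xs))"
    unfolding mset_map[symmetric] prod_mset_prod_list prod.list_conv_set_nth
    by (simp add: atLeast0LessThan)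
  then show ?thesis
    by (simp add: image_prod_mset_multiplicity count_mset)
qed

lemma mtilde_eq_aug_mono:
  "mtilde lam \<alpha> = (1 / (\<Prod>k\<in>set lam. fact (count_list lam k))) *
     aug_mono (\<lambda>k. ptilde k \<alpha>) {0..<length lam} ((!) lam)"
  by (simp add: mtilde_def aug_mono_def)

text \<open>The multiplicity factorials cancel against those in \<open>z_part\<close>, and n!
  cancels against the one in \<open>dim0\<close>. Each part then leaves lambda_i! / lambda_i =
  (lambda_i - 1)!, the Gamma value that the Dirichlet integral produces as well.\<close>

lemma M_t_div_dim0:
  assumes pos: "\<forall>k\<in>set lam. 0 < k"
  shows "(\<Prod>k\<in>set lam. fact (count_list lam k)) * (M_t t lam / dim0 lam) =
    t ^ length lam * (\<Prod>i<length lam. fact (lam ! i - 1)) / pochhammer t (sum_list lam)"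
proof -
  define C :: real where "C = (\<Prod>k\<in>set lam. fact (count_list lam k))"
  define L :: real where "L = (\<Prod>i<length lam. real (lam ! i))"
  define F :: real where "F = (\<Prod>i<length lam. fact (lam ! i - 1))"
  have C: "C \<noteq> 0" by (simp add: C_def)
  have L: "L \<noteq> 0" using pos by (auto simp: L_def)
  have z: "z_part lam = L * C"
    by (simp add: z_part_def L_def C_def prod.distrib prod_nth_eq_prod_count)
  have fac: "fact n = real n * fact (n - 1)" if "0 < n" for n
    using that by (simp add: fact_reduce)
  have P: "(\<Prod>i<length lam. fact (lam ! i)) = L * F"
    unfolding L_def F_def prod.distrib[symmetric] using pos by (intro prod.cong refl fac) auto
  show ?thesis
    unfolding M_t_def dim0_def z P C_def[symmetric] F_def[symmetric]
    using C L by (simp add: field_simps)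
qed

text \<open>The moment hypothesis speaks of weakly decreasing lists. Enumerating \<open>I\<close> by
  decreasing weight gives such a list, and relabelling identifies the two augmented
  functions.\<close>

lemma integral_aug_mono:
  fixes w :: "'a \<Rightarrow> nat"
  assumes moments: "\<And>lam. is_partition lam \<Longrightarrow> (\<integral>\<alpha>. mtilde lam \<alpha> \<partial>M) = M_t t lam / dim0 lam"
    and fin: "finite I" and pos: "\<And>i. i \<in> I \<Longrightarrow> 0 < w i"
  shows "(\<integral>\<alpha>. aug_mono (\<lambda>k. ptilde k \<alpha>) I w \<partial>M) =
    t ^ card I * (\<Prod>i\<in>I. fact (w i - 1)) / pochhammer t (\<Sum>i\<in>I. w i)"
proof -
  obtain xs where xs: "set xs = I" "distinct xs" using finite_distinct_list[OF fin] by blast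
  define ys where "ys = rev (sort_key w xs)"
  have ys: "set ys = I" "distinct ys" using xs by (auto simp: ys_def)
  define lam where "lam = map w ys"
  have len: "length ys = card I" using ys distinct_card by fastforce
  have lampos: "\<forall>k\<in>set lam. 0 < k" using pos ys by (auto simp: lam_def)
  have "sorted_wrt (\<ge>) lam"
    unfolding lam_def ys_def rev_map[symmetric] sorted_wrt_rev by simp
  then have lam: "is_partition lam" using lampos by (simp add: is_partition_def)
  have nth: "bij_betw ((!) ys) {0..<length lam} I"
    using ys by (auto simp: lam_def bij_betw_def inj_on_def nth_eq_iff_index_eq set_conv_nth)
  have aug: "aug_mono p I w = aug_mono p {0..<length lam} ((!) lam)" for p
  proof -
    have "aug_mono p I w = aug_mono p {0..<length lam} (w \<circ> (!) ys)"
      using aug_mono_image[of "{0..<length lam}" "(!) ys" p w] nth by (simp add: bij_betw_def)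
    also have "\<dots> = aug_mono p {0..<length lam} ((!) lam)"
      by (rule aug_mono_cong) (simp add: lam_def)
    finally show ?thesis .
  qed
  define C :: real where "C = (\<Prod>k\<in>set lam. fact (count_list lam k))"
  have C: "C \<noteq> 0" by (simp add: C_def)
  have "aug_mono (\<lambda>k. ptilde k \<alpha>) I w = C * mtilde lam \<alpha>" for \<alpha>
    using C by (simp add: aug mtilde_eq_aug_mono flip: C_def)
  then have "(\<integral>\<alpha>. aug_mono (\<lambda>k. ptilde k \<alpha>) I w \<partial>M) = C * (M_t t lam / dim0 lam)"
    by (simp add: moments[OF lam])
  also have "\<dots> = t ^ length lam * (\<Prod>i<length lam. fact (lam ! i - 1)) / pochhammer t (sum_list lam)"
    unfolding C_def by (rule M_t_div_dim0[OF lampos])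
  also have "(\<Prod>i<length lam. fact (lam ! i - 1) :: real) = (\<Prod>i\<in>I. fact (w i - 1))"
    using prod.reindex_bij_betw[OF nth, of "\<lambda>i. fact (w i - 1)"]
    by (simp add: lam_def atLeast0LessThan)
  also have "sum_list lam = (\<Sum>i\<in>I. w i)"
    using ys by (simp add: lam_def sum_list_distinct_conv_sum_set)
  finally show ?thesis by (simp add: lam_def len)
qed

section \<open>The Dirichlet integral\<close>

text \<open>The substitution y = c x reduces this to Beta(s + 1, b) = s! / (b)_(s+1). Nonpositive
  \<open>c\<close> must be covered because \<open>c\<close> will be the mass left over by other
  variables; then both sides vanish, as \<open>0 powr a = 0\<close>.\<close>

lemma nn_integral_beta_scaled:
  fixes b c :: real
  assumes b: "0 < b"
  shows "(\<integral>\<^sup>+y. ennreal (indicator {0..} y * y ^ s * max 0 (c - y) powr (b - 1)) \<partial>lborel) =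
    ennreal (max 0 c powr (b + real s) * (fact s / pochhammer b (Suc s)))"
proof (cases "0 < c")
  case False
  then have "ennreal (indicator {0..} y * y ^ s * max 0 (c - y) powr (b - 1)) = 0" for y
    by (auto simp: indicator_def max_def)
  then show ?thesis using False by (simp add: max_def)
next
  case c: True
  have Beta: "Beta (real s + 1) b = fact s / pochhammer b (Suc s)"
  proof -
    have "b \<notin> \<int>\<^sub>\<le>\<^sub>0" using b by (auto elim!: nonpos_Ints_cases)
    then show ?thesis
      using b by (simp add: Beta_def pochhammer_Gamma Gamma_fact[symmetric] add_ac)
  qed
  have "(\<integral>\<^sup>+y. ennreal (indicator {0..} y * y ^ s * max 0 (c - y) powr (b - 1)) \<partial>lborel) =
      ennreal c * (\<integral>\<^sup>+x. ennreal (indicator {0..} (c * x) * (c * x) ^ s * max 0 (c - c * x) powr (b - 1)) \<partial>lborel)"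
    using c by (subst nn_integral_real_affine[where c = c and t = 0]) auto
  also have "(\<integral>\<^sup>+x. ennreal (indicator {0..} (c * x) * (c * x) ^ s * max 0 (c - c * x) powr (b - 1)) \<partial>lborel) =
      (\<integral>\<^sup>+x. ennreal (c ^ s * c powr (b - 1)) *
         (ennreal (x powr (real s + 1 - 1) * (1 - x) powr (b - 1)) * indicator {0..1} x) \<partial>lborel)"
  proof (intro nn_integral_cong_AE)
    \<comment> \<open>The origin has to be excluded: for \<open>s = 0\<close> the power
      \<open>0 ^ 0\<close> is 1, whereas \<open>0 powr 0\<close> is 0.\<close>
    have "AE x in lborel. (x::real) \<noteq> 0" by (rule AE_lborel_singleton)
    then show "AE x in lborel. ennreal (indicator {0..} (c * x) * (c * x) ^ s * max 0 (c - c * x) powr (b - 1)) =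
      ennreal (c ^ s * c powr (b - 1)) *
         (ennreal (x powr (real s + 1 - 1) * (1 - x) powr (b - 1)) * indicator {0..1} x)"
    proof eventually_elim
      case (elim x)
      consider "x < 0" | "0 < x" "x \<le> 1" | "1 < x" using elim by linarith
      then show ?case
      proof cases
        case 1
        then have "c * x < 0" using c by (simp add: mult_pos_neg)
        then show ?thesis using 1 by simp
      next
        case 2
        have "max 0 (c - c * x) = c * (1 - x)" using 2 c by (simp add: algebra_simps max_def)
        then show ?thesis using 2 c
          by (simp add: powr_mult power_mult_distrib powr_realpow ennreal_mult[symmetric] mult_ac)
      next
        case 3
        then have "max 0 (c - c * x) = 0" using c by simp
        then show ?thesis using 3 by simp
      qed
    qed
  qed
  also have "\<dots> = ennreal (c ^ s * c powr (b - 1)) * ennreal (Beta (real s + 1) b)"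
    by (subst nn_integral_cmult)
       (use b in \<open>auto intro!: arg_cong2[where f = "(*)"] nn_integral_has_integral_lebesgue' has_integral_Beta_real[of "real s + 1" b, simplified]\<close>)
  also have "ennreal c * \<dots> = ennreal (max 0 c powr (b + real s) * (fact s / pochhammer b (Suc s)))"
  proof -
    have "c powr (b + real s) = c * (c ^ s * c powr (b - 1))"
      using c by (simp add: powr_add powr_diff powr_realpow)
    then show ?thesis using c b
      by (simp add: Beta ennreal_mult[symmetric] pochhammer_nonneg mult_ac)
  qed
  finally show ?thesis .
qed

text \<open>Integrating out all variables but y leaves a power of \<open>max 0 (c - y)\<close> with
  exponent b - 1 + N, hence a beta integral with b + N in place of b. The Pochhammer symbols
  multiply by (b)_(N+s+1) = (b)_N (b+N)_(s+1). The induction needs arbitrary \<open>c\<close> since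
  the inner integral is taken at c - y.\<close>

lemma nn_integral_dirichlet:
  fixes b c :: real and s :: "'a \<Rightarrow> nat"
  assumes "finite I" and b: "0 < b"
  shows "(\<integral>\<^sup>+y. ennreal ((\<Prod>i\<in>I. indicator {0..} (y i) * y i ^ s i) * max 0 (c - (\<Sum>i\<in>I. y i)) powr (b - 1))
      \<partial>PiM I (\<lambda>_. lborel)) =
    ennreal ((\<Prod>i\<in>I. fact (s i)) / pochhammer b (\<Sum>i\<in>I. Suc (s i)) *
      max 0 c powr (b - 1 + real (\<Sum>i\<in>I. Suc (s i))))"
  using \<open>finite I\<close>
proof (induction I arbitrary: c rule: finite_induct)
  case empty
  then show ?case by (simp add: PiM_empty nn_integral_count_space_finite)
next
  case (insert i I)
  interpret product_sigma_finite "\<lambda>_::'a. lborel :: real measure" by standard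
  define N where "N = (\<Sum>i\<in>I. Suc (s i))"
  define C :: real where "C = (\<Prod>i\<in>I. fact (s i)) / pochhammer b N"
  have C: "0 \<le> C" using b by (simp add: C_def prod_nonneg pochhammer_nonneg)
  have upd: "(\<Prod>j\<in>I. indicator {0..} ((x(i := y)) j) * (x(i := y)) j ^ s j) =
       (\<Prod>j\<in>I. indicator {0..} (x j) * x j ^ s j :: real)"
     "(\<Sum>j\<in>I. (x(i := y)) j) = (\<Sum>j\<in>I. x j)" for x y
    using insert.hyps by (auto intro!: prod.cong sum.cong)
  have nonneg: "0 \<le> indicator {0..} y * y ^ s i" for y :: real by (auto simp: indicator_def)
  have "(\<integral>\<^sup>+y. ennreal ((\<Prod>j\<in>insert i I. indicator {0..} (y j) * y j ^ s j) * max 0 (c - (\<Sum>j\<in>insert i I. y j)) powr (b - 1))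
      \<partial>PiM (insert i I) (\<lambda>_. lborel)) =
    (\<integral>\<^sup>+y. \<integral>\<^sup>+x. ennreal (indicator {0..} y * y ^ s i) *
        ennreal ((\<Prod>j\<in>I. indicator {0..} (x j) * x j ^ s j) * max 0 (c - y - (\<Sum>j\<in>I. x j)) powr (b - 1))
       \<partial>PiM I (\<lambda>_. lborel) \<partial>lborel)"
  proof (subst product_nn_integral_insert_rev)
    show "(\<lambda>y. ennreal ((\<Prod>j\<in>insert i I. indicator {0..} (y j) * y j ^ s j) * max 0 (c - (\<Sum>j\<in>insert i I. y j)) powr (b - 1)))
      \<in> borel_measurable (PiM (insert i I) (\<lambda>_. lborel))" by measurable
  qed (use insert.hyps nonneg in \<open>auto intro!: nn_integral_cong
         simp: upd ennreal_mult'[symmetric] mult_ac diff_diff_eq fun_upd_same simp del: fun_upd_apply\<close>)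
  also have "\<dots> = (\<integral>\<^sup>+y. ennreal (indicator {0..} y * y ^ s i) * ennreal (C * max 0 (c - y) powr (b - 1 + real N)) \<partial>lborel)"
    using insert.IH by (subst nn_integral_cmult) (auto simp: C_def N_def)
  also have "\<dots> = (\<integral>\<^sup>+y. ennreal C * ennreal (indicator {0..} y * y ^ s i * max 0 (c - y) powr (b + real N - 1)) \<partial>lborel)"
    using C nonneg by (intro nn_integral_cong) (auto simp: ennreal_mult'[symmetric] mult_ac algebra_simps)
  also have "\<dots> = ennreal C * ennreal (max 0 c powr (b + real N + real (s i)) * (fact (s i) / pochhammer (b + real N) (Suc (s i))))"
    using b by (simp add: nn_integral_cmult nn_integral_beta_scaled)
  also have "\<dots> = ennreal ((\<Prod>j\<in>insert i I. fact (s j)) / pochhammer b (\<Sum>j\<in>insert i I. Suc (s j)) *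
      max 0 c powr (b - 1 + real (\<Sum>j\<in>insert i I. Suc (s j))))"
  proof -
    have S: "(\<Sum>j\<in>insert i I. Suc (s j)) = N + Suc (s i)" using insert.hyps by (simp add: N_def)
    have F: "(\<Prod>j\<in>insert i I. fact (s j) :: real) = fact (s i) * (\<Prod>j\<in>I. fact (s j))"
      using insert.hyps by simp
    have "pochhammer b (N + Suc (s i)) = pochhammer b N * pochhammer (b + real N) (Suc (s i))"
      by (rule pochhammer_product')
    then show ?thesis unfolding S F C_def using C
      by (subst ennreal_mult'[symmetric]) (auto simp: C_def add_ac mult_ac)
  qed
  finally show ?case .
qed

section \<open>Measures on the unit cube are determined by their moments\<close>

text \<open>Weierstrass approximation on the interval carries equality from powers to continuous
  functions, and continuous ramps carry it on to the distribution functions. The support condition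
  also makes \<open>ennreal (x ^ k)\<close> agree almost everywhere with the real power.\<close>

lemma measure_eqI_moments_unit_interval:
  fixes M N :: "real measure"
  assumes fin: "finite_measure M" "finite_measure N"
    and sets: "sets M = sets borel" "sets N = sets borel"
    and ae: "AE x in M. x \<in> {0..1}" "AE x in N. x \<in> {0..1}"
    and moments: "\<And>k. (\<integral>\<^sup>+x. ennreal (x ^ k) \<partial>M) = (\<integral>\<^sup>+x. ennreal (x ^ k) \<partial>N)"
  shows "M = N"
proof -
  interpret M: finite_measure M by fact
  interpret N: finite_measure N by fact
  have bm: "f \<in> borel_measurable M \<longleftrightarrow> f \<in> borel_measurable borel"
    "f \<in> borel_measurable N \<longleftrightarrow> f \<in> borel_measurable borel" for f :: "real \<Rightarrow> real"
    using sets by (auto cong: measurable_cong_sets)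
  have int: "integrable M f" "integrable N f"
    if f: "continuous_on UNIV f" for f :: "real \<Rightarrow> real"
  proof -
    have "compact (f ` {0..1})"
      by (rule compact_continuous_image) (auto intro: continuous_on_subset[OF f])
    then obtain B where B: "\<And>x. x \<in> {0..1} \<Longrightarrow> norm (f x) \<le> B"
      by (metis bounded_iff compact_imp_bounded image_eqI)
    show "integrable M f"
    proof (rule M.integrable_const_bound)
      show "AE x in M. norm (f x) \<le> B" using ae(1) by eventually_elim (rule B)
    qed (simp add: bm borel_measurable_continuous_onI f)
    show "integrable N f"
    proof (rule N.integrable_const_bound)
      show "AE x in N. norm (f x) \<le> B" using ae(2) by eventually_elim (rule B)
    qed (simp add: bm borel_measurable_continuous_onI f)
  qed
  have pow: "(\<integral>x. x ^ k \<partial>M) = (\<integral>x. x ^ k \<partial>N)" for k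
  proof -
    have "(\<integral>x. x ^ k \<partial>M) = enn2real (\<integral>\<^sup>+x. ennreal (x ^ k) \<partial>M)"
      using ae(1) by (intro integral_eq_nn_integral) (auto simp: bm elim!: eventually_mono)
    moreover have "(\<integral>x. x ^ k \<partial>N) = enn2real (\<integral>\<^sup>+x. ennreal (x ^ k) \<partial>N)"
      using ae(2) by (intro integral_eq_nn_integral) (auto simp: bm elim!: eventually_mono)
    ultimately show ?thesis by (simp add: moments)
  qed
  have cont: "(\<integral>x. f x \<partial>M) = (\<integral>x. f x \<partial>N)" if f: "continuous_on UNIV f" for f :: "real \<Rightarrow> real"
  proof (rule ccontr)
    \<comment> \<open>The \<open>+ 1\<close> keeps \<open>m\<close> positive and gives a strict
      inequality below: the two approximation errors add up to at most \<open>e * (m - 1)\<close>,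
      while the assumed gap is exactly \<open>e * m\<close>.\<close>
    define m where "m = measure M (space M) + measure N (space N) + 1"
    have m: "m > 0" by (simp add: m_def add_nonneg_pos)
    assume "(\<integral>x. f x \<partial>M) \<noteq> (\<integral>x. f x \<partial>N)"
    define e where "e = \<bar>(\<integral>x. f x \<partial>M) - (\<integral>x. f x \<partial>N)\<bar> / m"
    have e: "e > 0" using \<open>_ \<noteq> _\<close> m by (simp add: e_def)
    obtain g where g: "real_polynomial_function g" and fg: "\<And>x. x \<in> {0..1} \<Longrightarrow> \<bar>f x - g x\<bar> < e"
      using Stone_Weierstrass_real_polynomial_function[of "{0..1}" f e] e
        continuous_on_subset[OF f] by auto
    obtain a n where gs: "g = (\<lambda>x. \<Sum>i\<le>n. a i * x ^ i)"
      using g by (auto simp: real_polynomial_function_iff_sum)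
    have cg: "continuous_on UNIV g" unfolding gs by (intro continuous_intros)
    have "integrable M (\<lambda>x. x ^ i)" "integrable N (\<lambda>x. x ^ i)" for i :: nat
      by (rule int; intro continuous_intros)+
    then have gint: "(\<integral>x. g x \<partial>M) = (\<integral>x. g x \<partial>N)" by (simp add: gs pow)
    have near: "\<bar>(\<integral>x. f x \<partial>L) - (\<integral>x. g x \<partial>L)\<bar> \<le> e * measure L (space L)"
      if L: "finite_measure L" "integrable L f" "integrable L g" "AE x in L. x \<in> {0..1}" for L
    proof -
      interpret L: finite_measure L by fact
      have "\<bar>(\<integral>x. f x \<partial>L) - (\<integral>x. g x \<partial>L)\<bar> = norm (\<integral>x. f x - g x \<partial>L)"
        using L by simp
      also have "\<dots> \<le> (\<integral>x. norm (f x - g x) \<partial>L)" by (rule integral_norm_bound)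
      also have "\<dots> \<le> (\<integral>x. e \<partial>L)"
      proof (rule integral_mono_AE)
        show "AE x in L. norm (f x - g x) \<le> e"
          using L(4) by eventually_elim (use fg in fastforce)
      qed (use L in auto)
      finally show ?thesis by (simp add: mult.commute)
    qed
    have "\<bar>(\<integral>x. f x \<partial>M) - (\<integral>x. g x \<partial>M)\<bar> \<le> e * measure M (space M)"
      "\<bar>(\<integral>x. f x \<partial>N) - (\<integral>x. g x \<partial>N)\<bar> \<le> e * measure N (space N)"
      using fin int[OF f] int[OF cg] ae by (auto intro!: near)
    then have "\<bar>(\<integral>x. f x \<partial>M) - (\<integral>x. f x \<partial>N)\<bar> \<le> e * (m - 1)"
      using gint by (simp add: m_def distrib_left)
    also have "\<dots> < e * m" using e by simp
    also have "\<dots> = \<bar>(\<integral>x. f x \<partial>M) - (\<integral>x. f x \<partial>N)\<bar>" using m by (simp add: e_def)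
    finally show False by simp
  qed
  have "cdf M = cdf N"
  proof
    fix a
    \<comment> \<open>A ramp that equals 1 up to \<open>a\<close> and then falls to 0 with slope -n.
      It is continuous, bounded by 1, and tends pointwise to the indicator of
      \<open>{..a}\<close>.\<close>
    define f where "f = (\<lambda>n x. max 0 (min 1 (1 - real n * (x - a))))"
    have cf: "continuous_on UNIV (f n)" for n
      unfolding f_def by (intro continuous_intros)
    have lim: "(\<lambda>n. f n x) \<longlonglongrightarrow> indicator {..a} x" for x
    proof (cases "x \<le> a")
      case True
      then have "real n * (x - a) \<le> 0" for n by (simp add: mult_nonneg_nonpos)
      then have "f n x = 1" for n by (simp add: f_def)
      then show ?thesis using True by simp
    next
      case False
      obtain n0 :: nat where n0: "1 / (x - a) < real n0" using reals_Archimedean2 by blast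
      have "f n x = 0" if "n \<ge> n0" for n
      proof -
        have "1 / (x - a) \<le> real n" using that n0 by linarith
        then have "1 \<le> real n * (x - a)" using False by (simp add: divide_le_eq mult.commute)
        then show ?thesis by (simp add: f_def)
      qed
      then have "eventually (\<lambda>n. f n x = 0) sequentially"
        unfolding eventually_sequentially by blast
      then show ?thesis using False by (simp add: tendsto_eventually)
    qed
    have "(\<lambda>n. \<integral>x. f n x \<partial>M) \<longlonglongrightarrow> (\<integral>x. indicator {..a} x \<partial>M)"
      by (rule integral_dominated_convergence[where w = "\<lambda>_. 1"])
        (use lim cf in \<open>auto simp: bm borel_measurable_continuous_onI f_def\<close>)
    moreover have "(\<lambda>n. \<integral>x. f n x \<partial>N) \<longlonglongrightarrow> (\<integral>x. indicator {..a} x \<partial>N)"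
      by (rule integral_dominated_convergence[where w = "\<lambda>_. 1"])
        (use lim cf in \<open>auto simp: bm borel_measurable_continuous_onI f_def\<close>)
    ultimately have "(\<integral>x. indicator {..a} x \<partial>M) = (\<integral>x. indicat_real {..a} x \<partial>N)"
      using cont[OF cf] LIMSEQ_unique by simp
    moreover have "{..a} \<in> sets M" "{..a} \<in> sets N" using sets by auto
    ultimately show "cdf M a = cdf N a"
      by (simp add: cdf_def)
  qed
  then show ?thesis
    using fin sets
    by (intro cdf_unique') (auto simp: finite_borel_measure_def finite_borel_measure_axioms_def)
qed

text \<open>Monomial factors are traded for indicators one coordinate at a time: with the other factors as
  a density, each trade is a one-dimensional moment problem for the law of that coordinate.\<close>

lemma measure_eqI_moments_unit_cube:
  fixes M N :: "('a \<Rightarrow> real) measure"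
  assumes I: "finite I"
    and fin: "finite_measure M" "finite_measure N"
    and sets: "sets M = sets (PiM I (\<lambda>_. borel))" "sets N = sets (PiM I (\<lambda>_. borel))"
    and ae: "\<And>i. i \<in> I \<Longrightarrow> AE x in M. x i \<in> {0..1}" "\<And>i. i \<in> I \<Longrightarrow> AE x in N. x i \<in> {0..1}"
    and moments: "\<And>k. (\<integral>\<^sup>+x. (\<Prod>i\<in>I. ennreal (x i ^ k i)) \<partial>M) = (\<integral>\<^sup>+x. (\<Prod>i\<in>I. ennreal (x i ^ k i)) \<partial>N)"
  shows "M = N"
proof -
  \<comment> \<open>The coordinates in \<open>J\<close> have already been traded. With
    \<open>J\<close> empty the integrals of \<open>G\<close> are the given moments; with
    \<open>J = I\<close> they are the measures of boxes.\<close>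
  define G where "G = (\<lambda>J k A (x :: 'a \<Rightarrow> real). (\<Prod>i\<in>I - J. ennreal (x i ^ k i)) * (\<Prod>i\<in>J. indicator (A i) (x i)) :: ennreal)"
  have comp: "(\<lambda>x. x i) \<in> borel_measurable L" if "i \<in> I" "sets L = sets (PiM I (\<lambda>_. borel))"
    for i and L :: "('a \<Rightarrow> real) measure"
    using that measurable_component_singleton[of i I "\<lambda>_. borel"] by (simp cong: measurable_cong_sets)
  have Gm: "G J k A \<in> borel_measurable L"
    if "J \<subseteq> I" "\<forall>i\<in>J. A i \<in> sets borel" and L: "sets L = sets (PiM I (\<lambda>_. borel))"
    for J k A and L :: "('a \<Rightarrow> real) measure"
  proof -
    have "(\<lambda>x. ennreal (x i ^ k i)) \<in> borel_measurable L" if "i \<in> I" for i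
      using comp[OF that L] by measurable
    moreover have "(\<lambda>x. indicator (A i) (x i) :: ennreal) \<in> borel_measurable L" if "i \<in> J" for i
      using measurable_compose[OF comp[OF _ L], of i "indicator (A i) :: real \<Rightarrow> ennreal" borel] that \<open>J \<subseteq> I\<close>
        \<open>\<forall>i\<in>J. A i \<in> sets borel\<close> by auto
    ultimately show ?thesis unfolding G_def
      by (intro borel_measurable_times_ennreal borel_measurable_prod_ennreal) auto
  qed
  have G1: "AE x in L. G J k A x \<le> 1"
    if "J \<subseteq> I" "\<And>i. i \<in> I \<Longrightarrow> AE x in L. x i \<in> {0..1}" for J k A and L :: "('a \<Rightarrow> real) measure"
  proof -
    have "AE x in L. \<forall>i\<in>I. x i \<in> {0..1}" using that(2) I by (simp add: AE_finite_all)
    then show ?thesis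
    proof eventually_elim
      case (elim x)
      have "(\<Prod>i\<in>I - J. ennreal (x i ^ k i)) \<le> (\<Prod>i\<in>I - J. 1)"
        using elim by (intro prod_mono_ennreal) (auto simp: power_le_one)
      moreover have "(\<Prod>i\<in>J. indicator (A i) (x i) :: ennreal) \<le> (\<Prod>i\<in>J. 1)"
        by (intro prod_mono_ennreal) (auto simp: indicator_def)
      ultimately show ?case unfolding G_def using mult_mono[of _ "1::ennreal" _ 1] by simp
    qed
  qed
  have key: "(\<integral>\<^sup>+x. G J k A x \<partial>M) = (\<integral>\<^sup>+x. G J k A x \<partial>N)"
    if "J \<subseteq> I" "\<forall>i\<in>J. A i \<in> sets borel" for J k A
    using finite_subset[OF that(1) I] that
  proof (induction J arbitrary: k rule: finite_induct)
    case empty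
    then show ?case using moments by (simp add: G_def)
  next
    case (insert j J)
    have j: "j \<in> I" "j \<notin> J" and J: "J \<subseteq> I" "\<forall>i\<in>J. A i \<in> sets borel" and Aj: "A j \<in> sets borel"
      using insert by auto
    define H where "H = (\<lambda>x. (\<Prod>i\<in>I - insert j J. ennreal (x i ^ k i)) * (\<Prod>i\<in>J. indicator (A i) (x i)) :: ennreal)"
    have Gj: "G J (k(j := m)) A x = H x * ennreal (x j ^ m)" for x m
    proof -
      define R where "R = I - insert j J"
      have R: "I - J = insert j R" "j \<notin> R" "finite R" using j I by (auto simp: R_def)
      have "(\<Prod>i\<in>R. ennreal (x i ^ (k(j := m)) i)) = (\<Prod>i\<in>R. ennreal (x i ^ k i))"
        using R(2) by (intro prod.cong) auto
      then show ?thesis using R(2,3)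
        unfolding G_def H_def R_def[symmetric] R(1) by (simp add: mult_ac)
    qed
    have GI: "G (insert j J) k A x = H x * indicator (A j) (x j)" for x
      using insert.hyps by (simp add: G_def H_def mult_ac)
    \<comment> \<open>Exponent 0 at \<open>j\<close> makes the missing factor 1, so \<open>H\<close>
      inherits measurability and the bound by 1 from \<open>G\<close>.\<close>
    have H0: "H = G J (k(j := 0)) A" using Gj[of 0] by (simp add: fun_eq_iff)
    \<comment> \<open>The law of coordinate \<open>j\<close> under \<open>L\<close> weighted by
      \<open>H\<close>. Its m-th moment is the integral of \<open>G J (k(j := m)) A\<close>, so the
      induction hypothesis, with \<open>k\<close> arbitrary, supplies equality of all
      moments.\<close>
    define L' where "L' = (\<lambda>L. distr (density L H) borel (\<lambda>x. x j))"
    have nn: "(\<integral>\<^sup>+y. f y \<partial>L' L) = (\<integral>\<^sup>+x. H x * f (x j) \<partial>L)"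
      if L: "sets L = sets (PiM I (\<lambda>_. borel))" and f: "f \<in> borel_measurable borel" for L f
      unfolding L'_def using comp[OF j(1) L] f Gm[OF J L]
      by (subst nn_integral_distr) (auto simp: nn_integral_density H0)
    have fin': "finite_measure (L' L)"
      if L: "sets L = sets (PiM I (\<lambda>_. borel))" "finite_measure L" "\<And>i. i \<in> I \<Longrightarrow> AE x in L. x i \<in> {0..1}" for L
    proof
      have "emeasure (L' L) (space (L' L)) = (\<integral>\<^sup>+y. 1 \<partial>L' L)" by simp
      also have "\<dots> = (\<integral>\<^sup>+x. H x \<partial>L)" using nn[OF L(1), of "\<lambda>_. 1"] by simp
      also have "\<dots> \<le> (\<integral>\<^sup>+x. 1 \<partial>L)" unfolding H0 by (intro nn_integral_mono_AE G1 J L)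
      also have "\<dots> < \<infinity>" using finite_measure.emeasure_finite[OF L(2)] by (simp add: top.not_eq_extremum)
      finally show "emeasure (L' L) (space (L' L)) \<noteq> \<infinity>" by simp
    qed
    have ae': "AE y in L' L. y \<in> {0..1}"
      if L: "sets L = sets (PiM I (\<lambda>_. borel))" "\<And>i. i \<in> I \<Longrightarrow> AE x in L. x i \<in> {0..1}" for L
    proof -
      have "AE x in density L H. x j \<in> {0..1}"
        using L(2)[OF j(1)] Gm[OF J L(1)]
        by (subst AE_density) (auto simp only: H0 elim!: eventually_mono)
      then show ?thesis
        unfolding L'_def using comp[OF j(1) L(1)] by (subst AE_distr_iff) auto
    qed
    have "L' M = L' N"
    proof (rule measure_eqI_moments_unit_interval)
      show "(\<integral>\<^sup>+x. ennreal (x ^ m) \<partial>L' M) = (\<integral>\<^sup>+x. ennreal (x ^ m) \<partial>L' N)" for m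
        using insert.IH[OF J, of "k(j := m)"] by (simp add: nn sets Gj[symmetric] del: fun_upd_apply)
    qed (use fin' ae' fin ae sets in \<open>auto simp: L'_def\<close>)
    then have "(\<integral>\<^sup>+y. indicator (A j) y \<partial>L' M) = (\<integral>\<^sup>+y. indicator (A j) y \<partial>L' N)" by simp
    then show ?case using Aj by (simp add: nn sets GI)
  qed
  show ?thesis
  proof (rule measure_eqI_PiM_finite[OF I sets])
    fix A :: "'a \<Rightarrow> real set" assume A: "\<And>i. i \<in> I \<Longrightarrow> A i \<in> sets borel"
    have box: "emeasure L (Pi\<^sub>E I A) = (\<integral>\<^sup>+x. G I k A x \<partial>L)"
      if L: "sets L = sets (PiM I (\<lambda>_. borel))" for L :: "('a \<Rightarrow> real) measure" and k
    proof -
      have sp: "space L = (\<Pi>\<^sub>E i\<in>I. UNIV)" using sets_eq_imp_space_eq[OF L] by (simp add: space_PiM)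
      have "Pi\<^sub>E I A \<in> sets L" using A I L by (simp add: sets_PiM_I_finite)
      then have "emeasure L (Pi\<^sub>E I A) = (\<integral>\<^sup>+x. indicator (Pi\<^sub>E I A) x \<partial>L)" by simp
      also have "\<dots> = (\<integral>\<^sup>+x. G I k A x \<partial>L)"
      proof (intro nn_integral_cong)
        fix x assume "x \<in> space L"
        then have "x \<in> Pi\<^sub>E I A \<longleftrightarrow> (\<forall>i\<in>I. x i \<in> A i)" by (auto simp: sp PiE_iff)
        then show "indicator (Pi\<^sub>E I A) x = G I k A x"
          using I by (auto simp: G_def indicator_def prod_zero_iff intro!: prod.neutral[symmetric])
      qed
      finally show ?thesis .
    qed
    show "emeasure M (Pi\<^sub>E I A) = emeasure N (Pi\<^sub>E I A)"
      using key[of I A "\<lambda>_. 0"] A box[OF sets(1), of "\<lambda>_. 0"] box[OF sets(2), of "\<lambda>_. 0"] by simp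
  next
    show "range (\<lambda>_. space M) \<subseteq> prod_algebra I (\<lambda>_. borel)"
      using I sets_eq_imp_space_eq[OF sets(1)]
      by (auto simp: space_PiM intro!: prod_algebraI_finite)
    show "emeasure M (space M) \<noteq> \<infinity>" for i :: nat
      using finite_measure.emeasure_finite[OF fin(1)] by simp
  qed (use sets_eq_imp_space_eq[OF sets(1)] in auto)
qed

section \<open>The controlling measure\<close>

lemma DeltaD:
  assumes "\<alpha> \<in> Delta"
  shows "0 \<le> \<alpha> i" "\<alpha> i \<le> 1" "summable \<alpha>" "suminf \<alpha> \<le> 1"
proof -
  show *: "0 \<le> \<alpha> i" "summable \<alpha>" "suminf \<alpha> \<le> 1" for i using assms by (auto simp: Delta_def)
  have "\<alpha> i = sum \<alpha> {i}" by simp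
  also have "\<dots> \<le> suminf \<alpha>" by (intro sum_le_suminf) (use * in auto)
  finally show "\<alpha> i \<le> 1" using *(3) by simp
qed

lemma summable_Delta_power:
  assumes "\<alpha> \<in> Delta"
  shows "summable (\<lambda>i. \<alpha> i ^ Suc k)"
proof (rule summable_comparison_test')
  show "summable \<alpha>" using DeltaD[OF assms] by simp
  show "norm (\<alpha> i ^ Suc k) \<le> \<alpha> i" for i
    using DeltaD(1,2)[OF assms, of i] by (auto simp: mult_left_le power_le_one)
qed

text \<open>Since alpha_i^k \<le> alpha_i, the sum is bounded by that of alpha. This bound makes all
  products of power sums integrable.\<close>

lemma ptilde_unit_interval:
  assumes "\<alpha> \<in> Delta" "0 < k"
  shows "ptilde k \<alpha> \<in> {0..1}"
proof -
  obtain m where k: "k = Suc m" using assms(2) by (cases k) auto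
  note \<alpha> = DeltaD[OF assms(1)]
  have "(\<Sum>i. \<alpha> i ^ Suc m) \<le> suminf \<alpha>"
    using \<alpha> summable_Delta_power[OF assms(1)]
    by (intro suminf_le) (auto simp: mult_left_le power_le_one)
  moreover have "0 \<le> (\<Sum>i. \<alpha> i ^ Suc m)"
    using \<alpha> summable_Delta_power[OF assms(1)] by (intro suminf_nonneg) auto
  ultimately show ?thesis using \<alpha>(4) unfolding ptilde_def k by auto
qed

text \<open>An atomic measure as the image of a weighted counting measure: index 0 carries the extra
  atom \<open>g\<close> at \<open>c\<close>, and index \<open>Suc i\<close> carries
  \<open>a i\<close>.\<close>

lemma nn_integral_distr_case_nat:
  fixes a :: "nat \<Rightarrow> real"
  assumes [measurable]: "f \<in> borel_measurable borel"
  shows "(\<integral>\<^sup>+x. f x \<partial>distr (density (count_space UNIV) (\<lambda>n. ennreal (case_nat g a n))) borel (case_nat c a)) =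
    (\<Sum>i. ennreal (a i) * f (a i)) + ennreal g * f c"
proof -
  have "(\<integral>\<^sup>+x. f x \<partial>distr (density (count_space UNIV) (\<lambda>n. ennreal (case_nat g a n))) borel (case_nat c a)) =
      (\<Sum>n. ennreal (case_nat g a n) * f (case_nat c a n))"
    by (subst nn_integral_distr, simp, simp, subst nn_integral_density)
       (simp_all add: nn_integral_count_space_nat)
  then show ?thesis 
    using suminf_offset[of "\<lambda>n. ennreal (case_nat g a n) * f (case_nat c a n)" 1] by simp
qed

text \<open>\<open>measure_of\<close> retains the prescribed set function only if it is countably
  additive. Recognizing it as the \<open>emeasure\<close> of an image measure settles this.\<close>

lemma thoma_measure_eq_distr:
  "thoma_measure \<alpha> =
     distr (density (count_space UNIV) (\<lambda>n. ennreal (case_nat (gamma_Thoma \<alpha>) \<alpha> n))) borel (case_nat 0 \<alpha>)"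
    (is "_ = ?D")
proof -
  have D: "emeasure ?D A = (\<Sum>i. ennreal (\<alpha> i) * indicator A (\<alpha> i)) + ennreal (gamma_Thoma \<alpha>) * indicator A 0"
    if "A \<in> sets borel" for A
    using nn_integral_distr_case_nat[of "indicator A"] that by simp
  have "thoma_measure \<alpha> = measure_of (space ?D) (sets ?D) (emeasure ?D)"
    unfolding thoma_measure_def space_distr sets_distr space_borel
    by (intro measure_of_eq) (simp_all add: D sets.sigma_sets_eq[of borel, simplified])
  then show ?thesis by (simp only: measure_of_of_measure)
qed

lemma sets_thoma_measure [simp, measurable_cong]: "sets (thoma_measure \<alpha>) = sets borel"
  by (simp add: thoma_measure_eq_distr)

lemma space_thoma_measure [simp]: "space (thoma_measure \<alpha>) = UNIV"
  by (simp add: thoma_measure_eq_distr)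

lemma nn_integral_thoma_measure:
  assumes "f \<in> borel_measurable borel"
  shows "(\<integral>\<^sup>+x. f x \<partial>thoma_measure \<alpha>) =
    (\<Sum>i. ennreal (\<alpha> i) * f (\<alpha> i)) + ennreal (gamma_Thoma \<alpha>) * f 0"
  unfolding thoma_measure_eq_distr by (rule nn_integral_distr_case_nat[OF assms])

text \<open>The weight alpha_i of the atom raises the exponent by one. The atom at 0 contributes
  gamma * 0^k, which is gamma for k = 0, completing the sum to p_1 = 1, and 0 for larger k.\<close>

lemma nn_integral_power_thoma_measure:
  assumes \<alpha>: "\<alpha> \<in> Delta"
  shows "(\<integral>\<^sup>+x. ennreal (x ^ k) \<partial>thoma_measure \<alpha>) = ennreal (ptilde (Suc k) \<alpha>)"
proof -
  have "(\<integral>\<^sup>+x. ennreal (x ^ k) \<partial>thoma_measure \<alpha>) =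
      (\<Sum>i. ennreal (\<alpha> i ^ Suc k)) + ennreal (gamma_Thoma \<alpha>) * ennreal (0 ^ k)"
    using DeltaD(1)[OF \<alpha>] by (subst nn_integral_thoma_measure) (auto simp: ennreal_mult')
  also have "(\<Sum>i. ennreal (\<alpha> i ^ Suc k)) = ennreal (\<Sum>i. \<alpha> i ^ Suc k)"
    using DeltaD(1)[OF \<alpha>] summable_Delta_power[OF \<alpha>] by (intro suminf_ennreal2) auto
  also have "\<dots> + ennreal (gamma_Thoma \<alpha>) * ennreal (0 ^ k) = ennreal (ptilde (Suc k) \<alpha>)"
  proof (cases k)
    case 0
    have "0 \<le> suminf \<alpha>" using DeltaD[OF \<alpha>] by (intro suminf_nonneg) auto
    then show ?thesis using DeltaD(4)[OF \<alpha>] 0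
      by (simp add: ptilde_def gamma_Thoma_def flip: ennreal_plus)
  qed (simp add: ptilde_def)
  finally show ?thesis .
qed

lemma prob_space_thoma_measure:
  assumes "\<alpha> \<in> Delta"
  shows "prob_space (thoma_measure \<alpha>)"
proof
  have "emeasure (thoma_measure \<alpha>) (space (thoma_measure \<alpha>)) = (\<integral>\<^sup>+x. ennreal (x ^ 0) \<partial>thoma_measure \<alpha>)"
    by simp
  also have "\<dots> = 1" by (subst nn_integral_power_thoma_measure[OF assms]) (simp add: ptilde_def)
  finally show "emeasure (thoma_measure \<alpha>) (space (thoma_measure \<alpha>)) = 1" .
qed

lemma AE_thoma_measure_unit_interval:
  assumes "\<alpha> \<in> Delta"
  shows "AE x in thoma_measure \<alpha>. x \<in> {0..1}"
  using DeltaD[OF assms]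
  unfolding thoma_measure_eq_distr
  by (subst AE_distr_iff) (auto simp: AE_density AE_count_space split: nat.split)

lemma nn_integral_PiM_thoma_measure:
  assumes \<alpha>: "\<alpha> \<in> Delta" and I: "finite I"
  shows "(\<integral>\<^sup>+x. (\<Prod>i\<in>I. ennreal (x i ^ k i)) \<partial>PiM I (\<lambda>_. thoma_measure \<alpha>)) =
    ennreal (\<Prod>i\<in>I. ptilde (Suc (k i)) \<alpha>)"
proof -
  interpret prob_space "thoma_measure \<alpha>" by (rule prob_space_thoma_measure[OF \<alpha>])
  interpret product_sigma_finite "\<lambda>_. thoma_measure \<alpha>" by standard
  have "(\<integral>\<^sup>+x. (\<Prod>i\<in>I. ennreal (x i ^ k i)) \<partial>PiM I (\<lambda>_. thoma_measure \<alpha>)) =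
      (\<Prod>i\<in>I. \<integral>\<^sup>+x. ennreal (x ^ k i) \<partial>thoma_measure \<alpha>)"
    using I by (intro product_nn_integral_prod) auto
  also have "\<dots> = (\<Prod>i\<in>I. ennreal (ptilde (Suc (k i)) \<alpha>))"
    by (simp add: nn_integral_power_thoma_measure[OF \<alpha>])
  also have "\<dots> = ennreal (\<Prod>i\<in>I. ptilde (Suc (k i)) \<alpha>)"
    using ptilde_unit_interval[OF \<alpha>] by (intro prod_ennreal) auto
  finally show ?thesis .
qed

section \<open>Mixtures of the product measures over random sequences\<close>

context
  fixes M :: "(nat \<Rightarrow> real) measure"
  assumes prob: "prob_space M" and sets_M: "sets M = sets (restrict_space borel Delta)"
begin

lemma space_Delta_measure: "space M = Delta"
  using sets_eq_imp_space_eq[OF sets_M] by (simp add: space_restrict_space)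

lemma coordinate_measurable: "(\<lambda>\<alpha>. \<alpha> i) \<in> borel_measurable M"
  unfolding measurable_cong_sets[OF sets_M refl]
  by (intro measurable_restrict_space1 measurable_product_coordinates)

lemma ptilde_measurable: "ptilde k \<in> borel_measurable M"
proof -
  note coordinate_measurable[measurable]
  show ?thesis unfolding ptilde_def by measurable
qed

lemma emeasure_thoma_measurable:
  assumes [measurable]: "A \<in> sets borel"
  shows "(\<lambda>\<alpha>. emeasure (thoma_measure \<alpha>) A) \<in> borel_measurable M"
proof -
  note coordinate_measurable[measurable]
  have "emeasure (thoma_measure \<alpha>) A =
      (\<Sum>i. ennreal (\<alpha> i) * indicator A (\<alpha> i)) + ennreal (gamma_Thoma \<alpha>) * indicator A 0" for \<alpha>
    using nn_integral_thoma_measure[of "indicator A" \<alpha>] assms by simp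
  then show ?thesis by (simp add: gamma_Thoma_def)
qed

text \<open>Measurability of a family of probability measures need only be tested on an
  intersection-stable generator. On boxes the product measure is a finite product of one-dimensional
  masses, each measurable in alpha.\<close>

lemma PiM_thoma_kernel:
  assumes I: "finite I"
  shows "(\<lambda>\<alpha>. PiM I (\<lambda>_. thoma_measure \<alpha>)) \<in> M \<rightarrow>\<^sub>M prob_algebra (PiM I (\<lambda>_. borel))"
proof (rule measurable_prob_algebra_generated)
  show "sets (PiM I (\<lambda>_. borel :: real measure)) =
      sigma_sets (\<Pi>\<^sub>E i\<in>I. space borel) (prod_algebra I (\<lambda>_. borel))"
    by (rule sets_PiM)
  show "prod_algebra I (\<lambda>_. borel :: real measure) \<subseteq> Pow (\<Pi>\<^sub>E i\<in>I. space borel)"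
    by (rule prod_algebra_sets_into_space)
  show "prob_space (PiM I (\<lambda>_. thoma_measure \<alpha>))" if "\<alpha> \<in> space M" for \<alpha>
    using that by (intro prob_space_PiM prob_space_thoma_measure) (simp add: space_Delta_measure)
  fix A assume "A \<in> prod_algebra I (\<lambda>_. borel :: real measure)"
  then obtain X where A: "A = Pi\<^sub>E I X" and X: "\<And>i. i \<in> I \<Longrightarrow> X i \<in> sets borel"
    using I by (auto simp: prod_algebra_eq_finite)
  have "emeasure (PiM I (\<lambda>_. thoma_measure \<alpha>)) A = (\<Prod>i\<in>I. emeasure (thoma_measure \<alpha>) (X i))"
    if "\<alpha> \<in> space M" for \<alpha>
  proof -
    interpret prob_space "thoma_measure \<alpha>"
      using that by (intro prob_space_thoma_measure) (simp add: space_Delta_measure)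
    interpret product_sigma_finite "\<lambda>_. thoma_measure \<alpha>" by standard
    show ?thesis unfolding A using I X by (intro emeasure_PiM) auto
  qed
  moreover have "(\<lambda>\<alpha>. \<Prod>i\<in>I. emeasure (thoma_measure \<alpha>) (X i)) \<in> borel_measurable M"
    using X by (intro borel_measurable_prod_ennreal emeasure_thoma_measurable)
  ultimately show "(\<lambda>\<alpha>. emeasure (PiM I (\<lambda>_. thoma_measure \<alpha>)) A) \<in> borel_measurable M"
    by (simp cong: measurable_cong)
next
  show "sets (PiM I (\<lambda>_. thoma_measure \<alpha>)) = sets (PiM I (\<lambda>_. borel))" for \<alpha>
    by (intro sets_PiM_cong) auto
qed (rule Int_stable_prod_algebra)

text \<open>As for the Thoma measure, this shows that the set function passed to
  \<open>measure_of\<close> is countably additive. It also makes integrals and null sets of the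
  mixture computable fibrewise.\<close>

lemma controlling_measure_eq_bind:
  "controlling_measure M n = M \<bind> (\<lambda>\<alpha>. PiM {0..<n} (\<lambda>_. thoma_measure \<alpha>))" (is "_ = ?B")
proof -
  have M: "M \<in> space (prob_algebra M)" using prob by (simp add: space_prob_algebra)
  have K: "(\<lambda>\<alpha>. PiM {0..<n} (\<lambda>_. thoma_measure \<alpha>)) \<in> M \<rightarrow>\<^sub>M prob_algebra (PiM {0..<n} (\<lambda>_. borel))"
    by (rule PiM_thoma_kernel) simp
  have sets: "sets ?B = sets (PiM {0..<n} (\<lambda>_. borel))" by (rule sets_bind'[OF M K])
  have "controlling_measure M n = measure_of (space ?B) (sets ?B) (emeasure ?B)"
    unfolding controlling_measure_def sets sets_eq_imp_space_eq[OF sets]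
    by (intro measure_of_eq) (auto simp: sets.space_closed sets.sigma_sets_eq emeasure_bind_prob_algebra[OF M K])
  then show ?thesis by (simp only: measure_of_of_measure)
qed

lemma
  shows prob_space_controlling_measure: "prob_space (controlling_measure M n)"
    and sets_controlling_measure: "sets (controlling_measure M n) = sets (PiM {0..<n} (\<lambda>_. borel))"
proof -
  have M: "M \<in> space (prob_algebra M)" using prob by (simp add: space_prob_algebra)
  note K = PiM_thoma_kernel[OF finite_atLeastLessThan[of 0 n]]
  show "prob_space (controlling_measure M n)" "sets (controlling_measure M n) = sets (PiM {0..<n} (\<lambda>_. borel))"
    unfolding controlling_measure_eq_bind by (rule prob_space_bind'[OF M K] sets_bind'[OF M K])+
qed

lemma AE_controlling_measure:
  assumes i: "i < n"
  shows "AE x in controlling_measure M n. x i \<in> {0..1}"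
proof -
  have "AE x in PiM {0..<n} (\<lambda>_. thoma_measure \<alpha>). x i \<in> {0..1}" if "\<alpha> \<in> space M" for \<alpha>
    using that i
    by (intro AE_PiM_component prob_space_thoma_measure AE_thoma_measure_unit_interval) (auto simp: space_Delta_measure)
  moreover have "Measurable.pred (PiM {0..<n} (\<lambda>_. borel)) (\<lambda>x. x i \<in> {0..1::real})"
  proof -
    have [measurable]: "(\<lambda>x. x i) \<in> borel_measurable (PiM {0..<n} (\<lambda>_. borel :: real measure))"
      using i by (intro measurable_component_singleton) simp
    show ?thesis by measurable
  qed
  ultimately show ?thesis
    unfolding controlling_measure_eq_bind
    by (subst AE_bind[OF measurable_prob_algebraD[OF PiM_thoma_kernel]]) auto
qed

lemma nn_integral_controlling_measure:
  "(\<integral>\<^sup>+x. (\<Prod>i\<in>{0..<n}. ennreal (x i ^ k i)) \<partial>controlling_measure M n) =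
    ennreal (\<integral>\<alpha>. (\<Prod>i\<in>{0..<n}. ptilde (Suc (k i)) \<alpha>) \<partial>M)"
proof -
  note ptilde_measurable[measurable]
  interpret prob_space M by (rule prob)
  have "(\<integral>\<^sup>+x. (\<Prod>i\<in>{0..<n}. ennreal (x i ^ k i)) \<partial>controlling_measure M n) =
      (\<integral>\<^sup>+\<alpha>. \<integral>\<^sup>+x. (\<Prod>i\<in>{0..<n}. ennreal (x i ^ k i)) \<partial>PiM {0..<n} (\<lambda>_. thoma_measure \<alpha>) \<partial>M)"
    unfolding controlling_measure_eq_bind
    by (rule nn_integral_bind[OF _ measurable_prob_algebraD[OF PiM_thoma_kernel]]) auto
  also have "\<dots> = (\<integral>\<^sup>+\<alpha>. ennreal (\<Prod>i\<in>{0..<n}. ptilde (Suc (k i)) \<alpha>) \<partial>M)"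
    by (intro nn_integral_cong nn_integral_PiM_thoma_measure) (auto simp: space_Delta_measure)
  also have "\<dots> = ennreal (\<integral>\<alpha>. (\<Prod>i\<in>{0..<n}. ptilde (Suc (k i)) \<alpha>) \<partial>M)"
  proof (rule nn_integral_eq_integral)
    have *: "0 \<le> ptilde (Suc (k i)) \<alpha>" "ptilde (Suc (k i)) \<alpha> \<le> 1" if "\<alpha> \<in> Delta" for \<alpha> i
      using ptilde_unit_interval[OF that, of "Suc (k i)"] by auto
    show "integrable M (\<lambda>\<alpha>. \<Prod>i\<in>{0..<n}. ptilde (Suc (k i)) \<alpha>)"
      using * by (intro integrable_const_bound[where B = 1])
        (auto intro!: AE_I2 simp: space_Delta_measure prod_nonneg prod_le_1)
    show "AE \<alpha> in M. 0 \<le> (\<Prod>i\<in>{0..<n}. ptilde (Suc (k i)) \<alpha>)"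
      using * by (intro AE_I2 prod_nonneg) (auto simp: space_Delta_measure)
  qed
  finally show ?thesis .
qed

lemma integrable_aug_mono:
  assumes I: "finite I" and pos: "\<And>i. i \<in> I \<Longrightarrow> 0 < w i"
  shows "integrable M (\<lambda>\<alpha>. aug_mono (\<lambda>k. ptilde k \<alpha>) I w)"
proof -
  note ptilde_measurable[measurable]
  interpret prob_space M by (rule prob)
  have "integrable M (\<lambda>\<alpha>. \<Prod>B\<in>P. ptilde (\<Sum>i\<in>B. w i) \<alpha>)" if P: "partition_on I P" for P
  proof -
    \<comment> \<open>Merged parts have index at least 1, where \<open>ptilde\<close> takes values
      in [0,1] on \<open>Delta\<close>.\<close>
    have "0 < (\<Sum>i\<in>B. w i)" if "B \<in> P" for B
    proof -
      have "B \<subseteq> I" "B \<noteq> {}" using P that by (auto simp: partition_on_def)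
      then show ?thesis using pos I by (intro sum_pos) (blast intro: finite_subset)+
    qed
    then have *: "0 \<le> ptilde (\<Sum>i\<in>B. w i) \<alpha>" "ptilde (\<Sum>i\<in>B. w i) \<alpha> \<le> 1" if "\<alpha> \<in> Delta" "B \<in> P" for \<alpha> B
      using ptilde_unit_interval[of \<alpha> "\<Sum>i\<in>B. w i"] that by auto
    show ?thesis
      using * by (intro integrable_const_bound[where B = 1])
        (auto intro!: AE_I2 simp: space_Delta_measure prod_nonneg prod_le_1)
  qed
  then show ?thesis unfolding aug_mono_def prod.distrib by auto
qed

text \<open>The expansion into augmented functions is integrated termwise, with the blocks of
  \<open>P\<close> as indices and their weights as parts. All terms share one Pochhammer symbol
  because the block weights add up to the total weight of \<open>I\<close>.\<close>

lemma integral_prod_ptilde: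
  assumes moments: "\<And>lam. is_partition lam \<Longrightarrow> (\<integral>\<alpha>. mtilde lam \<alpha> \<partial>M) = M_t t lam / dim0 lam"
    and I: "finite I" and pos: "\<And>i. i \<in> I \<Longrightarrow> 0 < w i"
  shows "(\<integral>\<alpha>. (\<Prod>i\<in>I. ptilde (w i) \<alpha>) \<partial>M) =
    (\<Sum>P | partition_on I P. t ^ card P * (\<Prod>B\<in>P. fact ((\<Sum>i\<in>B. w i) - 1)) / pochhammer t (\<Sum>i\<in>I. w i))"
proof -
  have P: "finite P" "\<And>B. B \<in> P \<Longrightarrow> 0 < (\<Sum>i\<in>B. w i)" "(\<Sum>B\<in>P. \<Sum>i\<in>B. w i) = (\<Sum>i\<in>I. w i)"
    if P: "partition_on I P" for P
  proof -
    show "finite P" using P I by (rule finite_elements[rotated])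
    have sub: "B \<subseteq> I" if "B \<in> P" for B using P that by (auto simp: partition_on_def)
    show "0 < (\<Sum>i\<in>B. w i)" if "B \<in> P" for B
    proof -
      have "B \<noteq> {}" using P that by (auto simp: partition_on_def)
      then show ?thesis using sub[OF that] pos I by (intro sum_pos) (blast intro: finite_subset)+
    qed
    have "\<forall>B\<in>P. finite B" using sub I finite_subset by blast
    then show "(\<Sum>B\<in>P. \<Sum>i\<in>B. w i) = (\<Sum>i\<in>I. w i)"
      using P sum.Union_disjoint[of P w] by (auto simp: partition_on_def disjoint_def)
  qed
  have "(\<integral>\<alpha>. (\<Prod>i\<in>I. ptilde (w i) \<alpha>) \<partial>M) =
      (\<integral>\<alpha>. (\<Sum>P | partition_on I P. aug_mono (\<lambda>k. ptilde k \<alpha>) P (\<lambda>B. \<Sum>i\<in>B. w i)) \<partial>M)"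
    by (simp add: sum_aug_mono_partition[OF I])
  also have "\<dots> = (\<Sum>P | partition_on I P. \<integral>\<alpha>. aug_mono (\<lambda>k. ptilde k \<alpha>) P (\<lambda>B. \<Sum>i\<in>B. w i) \<partial>M)"
    using P by (intro Bochner_Integration.integral_sum integrable_aug_mono) auto
  also have "\<dots> = (\<Sum>P | partition_on I P. t ^ card P * (\<Prod>B\<in>P. fact ((\<Sum>i\<in>B. w i) - 1)) /
      pochhammer t (\<Sum>B\<in>P. \<Sum>i\<in>B. w i))"
    using P by (intro sum.cong refl integral_aug_mono moments) auto
  finally show ?thesis using P(3) by simp
qed

end

section \<open>The block measures\<close>

lemma block_embed_in_block:
  assumes P: "partition_on {0..<n} P" and B: "B \<in> P" "j \<in> B"
  shows "block_embed n P y j = y B"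
proof -
  have "j \<in> {0..<n}" using P B by (auto simp: partition_on_def)
  moreover have "(THE B. B \<in> P \<and> j \<in> B) = B"
    using P B by (intro the_equality) (auto simp: partition_on_def disjoint_def)
  ultimately show ?thesis by (simp add: block_embed_def)
qed

lemma block_embed_measurable:
  assumes P: "partition_on {0..<n} P"
  shows "block_embed n P \<in> PiM P (\<lambda>_. lborel) \<rightarrow>\<^sub>M PiM {0..<n} (\<lambda>_. borel :: real measure)"
  unfolding block_embed_def
proof (rule measurable_restrict)
  fix j assume "j \<in> {0..<n}"
  then obtain B where B: "B \<in> P" "j \<in> B" using partition_onD1[OF P] by blast
  then have "(THE B. B \<in> P \<and> j \<in> B) = B"
    using P by (intro the_equality) (auto simp: partition_on_def disjoint_def)
  moreover have "(\<lambda>y. y B) \<in> PiM P (\<lambda>_. lborel) \<rightarrow>\<^sub>M (lborel :: real measure)"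
    using B by (intro measurable_component_singleton)
  ultimately show "(\<lambda>y. y (THE B. B \<in> P \<and> j \<in> B)) \<in> PiM P (\<lambda>_. lborel) \<rightarrow>\<^sub>M (borel :: real measure)"
    by simp
qed

lemma block_density_measurable:
  assumes "finite P"
  shows "block_density t P \<in> borel_measurable (PiM P (\<lambda>_. lborel))"
proof -
  have [measurable]: "(\<lambda>y. y B) \<in> borel_measurable (PiM P (\<lambda>_. lborel))" if "B \<in> P" for B
    using measurable_component_singleton[OF that, of "\<lambda>_. lborel"] by simp
  have [measurable]: "PiE P (\<lambda>_. {0..1::real}) \<in> sets (PiM P (\<lambda>_. lborel))"
    using assms by (intro sets_PiM_I_finite) auto
  show ?thesis unfolding block_density_def by measurable
qed

lemma sets_sigma_block [simp]: "sets (sigma_block t n P) = sets (PiM {0..<n} (\<lambda>_. borel))"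
  by (simp add: sigma_block_def)

lemma AE_sigma_block:
  assumes P: "partition_on {0..<n} P" and j: "j < n"
  shows "AE x in sigma_block t n P. x j \<in> {0..1}"
proof -
  have finP: "finite P" using P by (rule finite_elements[rotated]) simp
  obtain B where B: "B \<in> P" "j \<in> B" using partition_onD1[OF P] j by (metis UnionE atLeastLessThan_iff le0)
  have [measurable]: "(\<lambda>x. x j) \<in> borel_measurable (PiM {0..<n} (\<lambda>_. borel :: real measure))"
    using j by (intro measurable_component_singleton) simp
  have "AE y in density (PiM P (\<lambda>_. lborel)) (block_density t P). block_embed n P y j \<in> {0..1}"
    using B by (auto simp: AE_density block_density_measurable[OF finP] block_embed_in_block[OF P B]
        block_density_def indicator_def PiE_iff split: if_splits)
  then show ?thesis
    unfolding sigma_block_def using block_embed_measurable[OF P]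
    by (subst AE_distr_iff) (auto simp: measurable_density_eq1)
qed

text \<open>The constraint \<open>y B \<le> 1\<close> can be dropped on the right: if it fails for nonnegative \<open>y\<close>, then
  the last factor is \<open>0 powr (t - 1) = 0\<close>.\<close>

lemma block_density_times_powers:
  fixes k :: "nat \<Rightarrow> nat" and t :: real
  assumes P: "partition_on {0..<n} P" and t: "0 < t" and y: "y \<in> extensional P"
  shows "block_density t P y * (\<Prod>i\<in>{0..<n}. ennreal (block_embed n P y i ^ k i)) =
    ennreal (t ^ card P) * ennreal ((\<Prod>B\<in>P. indicator {0..} (y B) * y B ^ ((\<Sum>i\<in>B. Suc (k i)) - 1)) *
      max 0 (1 - (\<Sum>B\<in>P. y B)) powr (t - 1))"
proof (cases "\<forall>B\<in>P. y B \<in> {0..1}")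
  case True
  have finP: "finite P" using P by (rule finite_elements[rotated]) simp
  have fin: "finite B" if "B \<in> P" for B
    using P that by (auto simp: partition_on_def intro: finite_subset[of B "{0..<n}"])
  have card: "0 < card B" if "B \<in> P" for B
    using fin[OF that] P that by (auto simp: partition_on_def card_gt_0_iff)
  have "(\<Prod>i\<in>{0..<n}. block_embed n P y i ^ k i) = (\<Prod>B\<in>P. \<Prod>i\<in>B. block_embed n P y i ^ k i)"
  proof -
    have "{0..<n} = \<Union>P" using P by (simp add: partition_on_def)
    then show ?thesis
      using fin P by (simp only:) (subst prod.Union_disjoint, auto simp: partition_on_def disjoint_def)
  qed
  also have "\<dots> = (\<Prod>B\<in>P. y B ^ (\<Sum>i\<in>B. k i))"
    using block_embed_in_block[OF P] by (intro prod.cong) (auto simp: power_sum)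
  finally have emb: "(\<Prod>i\<in>{0..<n}. block_embed n P y i ^ k i) = (\<Prod>B\<in>P. y B ^ (\<Sum>i\<in>B. k i))" .
  have nonneg: "0 \<le> block_embed n P y i ^ k i" if i: "i \<in> {0..<n}" for i
  proof -
    obtain B where "B \<in> P" "i \<in> B" using partition_onD1[OF P] i by blast
    then show ?thesis using True block_embed_in_block[OF P] by simp
  qed
  have prods: "(\<Prod>B\<in>P. y B ^ (card B - 1)) * (\<Prod>B\<in>P. y B ^ (\<Sum>i\<in>B. k i)) =
      (\<Prod>B\<in>P. indicator {0..} (y B) * y B ^ ((\<Sum>i\<in>B. Suc (k i)) - 1))"
    unfolding prod.distrib[symmetric]
  proof (intro prod.cong refl)
    fix B assume B: "B \<in> P"
    have "(\<Sum>i\<in>B. Suc (k i)) - 1 = (card B - 1) + (\<Sum>i\<in>B. k i)"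
      using card[OF B] by (simp add: sum_Suc)
    then show "y B ^ (card B - 1) * y B ^ (\<Sum>i\<in>B. k i) =
        indicator {0..} (y B) * y B ^ ((\<Sum>i\<in>B. Suc (k i)) - 1)"
      using True B by (simp add: power_add)
  qed
  have nn: "0 \<le> (\<Prod>B\<in>P. y B ^ (\<Sum>i\<in>B. k i))" using True by (intro prod_nonneg) auto
  have "y \<in> PiE P (\<lambda>_. {0..1})" using True y by (auto simp: PiE_iff)
  moreover have "(\<Prod>i\<in>{0..<n}. ennreal (block_embed n P y i ^ k i)) = ennreal (\<Prod>B\<in>P. y B ^ (\<Sum>i\<in>B. k i))"
    by (subst prod_ennreal[OF nonneg]) (simp_all only: emb)
  ultimately have "block_density t P y * (\<Prod>i\<in>{0..<n}. ennreal (block_embed n P y i ^ k i)) =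
      ennreal (t ^ card P * (\<Prod>B\<in>P. y B ^ (card B - 1)) * max 0 (1 - (\<Sum>B\<in>P. y B)) powr (t - 1)) *
      ennreal (\<Prod>B\<in>P. y B ^ (\<Sum>i\<in>B. k i))"
    by (simp add: block_density_def)
  also have "\<dots> = ennreal (t ^ card P * (((\<Prod>B\<in>P. y B ^ (card B - 1)) * (\<Prod>B\<in>P. y B ^ (\<Sum>i\<in>B. k i))) *
      max 0 (1 - (\<Sum>B\<in>P. y B)) powr (t - 1)))"
    by (simp only: ennreal_mult''[OF nn, symmetric]) (simp only: mult_ac)
  finally show ?thesis
    unfolding prods using t by (simp add: ennreal_mult')
next
  case False
  have finP: "finite P" using P by (rule finite_elements[rotated]) simp
  have zero: "(\<Prod>B\<in>P. indicator {0..} (y B) * y B ^ ((\<Sum>i\<in>B. Suc (k i)) - 1)) *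
      max 0 (1 - (\<Sum>B\<in>P. y B)) powr (t - 1) = 0"
  proof (cases "\<exists>B\<in>P. y B < 0")
    case True
    then have "(\<Prod>B\<in>P. indicator {0..} (y B) * y B ^ ((\<Sum>i\<in>B. Suc (k i)) - 1)) = 0"
      using finP by (force simp: prod_zero_iff)
    then show ?thesis by simp
  next
    case nonneg: False
    with False obtain B where "B \<in> P" "1 < y B" by fastforce
    moreover have "y B \<le> (\<Sum>B\<in>P. y B)" if "B \<in> P" for B
      using nonneg finP that by (intro member_le_sum) (auto simp: not_less)
    ultimately have "max 0 (1 - (\<Sum>B\<in>P. y B)) = 0" by fastforce
    then show ?thesis by simp
  qed
  have "y \<notin> PiE P (\<lambda>_. {0..1})" using False by (auto simp: PiE_iff)
  then show ?thesis unfolding zero by (simp add: block_density_def)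
qed

lemma nn_integral_sigma_block:
  assumes P: "partition_on {0..<n} P" and t: "0 < t"
  shows "(\<integral>\<^sup>+x. (\<Prod>i\<in>{0..<n}. ennreal (x i ^ k i)) \<partial>sigma_block t n P) =
    ennreal (t ^ card P * (\<Prod>B\<in>P. fact ((\<Sum>i\<in>B. Suc (k i)) - 1)) / pochhammer t (\<Sum>i\<in>{0..<n}. Suc (k i)))"
proof -
  have finP: "finite P" using P by (rule finite_elements[rotated]) simp
  have fin: "finite B" if "B \<in> P" for B
    using P that by (auto simp: partition_on_def intro: finite_subset[of B "{0..<n}"])
  \<comment> \<open>The exponent of \<open>y B\<close>: the density gives \<open>card B - 1\<close>,
    and every coordinate \<open>i\<close> in \<open>B\<close> adds \<open>k i\<close>. Thus
    \<open>Suc (s B)\<close> is the merged part belonging to \<open>B\<close>.\<close>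
  define s where "s = (\<lambda>B. (\<Sum>i\<in>B. Suc (k i)) - 1)"
  have "Suc (s B) = (\<Sum>i\<in>B. Suc (k i))" if "B \<in> P" for B
  proof -
    have "0 < card B" using fin[OF that] P that by (auto simp: card_gt_0_iff partition_on_def)
    then show ?thesis by (simp add: s_def sum_Suc)
  qed
  then have "(\<Sum>B\<in>P. Suc (s B)) = (\<Sum>B\<in>P. \<Sum>i\<in>B. Suc (k i))" by simp
  also have "\<dots> = (\<Sum>i\<in>{0..<n}. Suc (k i))"
  proof -
    have "{0..<n} = \<Union>P" using P by (simp add: partition_on_def)
    then show ?thesis
      using fin P by (simp only:) (subst sum.Union_disjoint, auto simp: partition_on_def disjoint_def)
  qed
  finally have total: "(\<Sum>B\<in>P. Suc (s B)) = (\<Sum>i\<in>{0..<n}. Suc (k i))" .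
  have "(\<integral>\<^sup>+x. (\<Prod>i\<in>{0..<n}. ennreal (x i ^ k i)) \<partial>sigma_block t n P) =
      (\<integral>\<^sup>+y. block_density t P y * (\<Prod>i\<in>{0..<n}. ennreal (block_embed n P y i ^ k i)) \<partial>PiM P (\<lambda>_. lborel))"
    unfolding sigma_block_def
  proof (subst nn_integral_distr)
    show "block_embed n P \<in> density (PiM P (\<lambda>_. lborel)) (block_density t P) \<rightarrow>\<^sub>M PiM {0..<n} (\<lambda>_. borel)"
      using block_embed_measurable[OF P] by simp
    have mono: "(\<lambda>x. \<Prod>i\<in>{0..<n}. ennreal (x i ^ k i)) \<in> borel_measurable (PiM {0..<n} (\<lambda>_. borel))"
      by measurable
    then show "(\<lambda>x. \<Prod>i\<in>{0..<n}. ennreal (x i ^ k i)) \<in> borel_measurable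
        (distr (density (PiM P (\<lambda>_. lborel)) (block_density t P)) (PiM {0..<n} (\<lambda>_. borel)) (block_embed n P))"
      by simp
    show "(\<integral>\<^sup>+y. (\<Prod>i\<in>{0..<n}. ennreal (block_embed n P y i ^ k i)) \<partial>density (PiM P (\<lambda>_. lborel)) (block_density t P)) =
      (\<integral>\<^sup>+y. block_density t P y * (\<Prod>i\<in>{0..<n}. ennreal (block_embed n P y i ^ k i)) \<partial>PiM P (\<lambda>_. lborel))"
      using measurable_compose[OF block_embed_measurable[OF P] mono]
      by (intro nn_integral_density block_density_measurable finP)
  qed
  also have "\<dots> = (\<integral>\<^sup>+y. ennreal (t ^ card P) * ennreal ((\<Prod>B\<in>P. indicator {0..} (y B) * y B ^ s B) *
      max 0 (1 - (\<Sum>B\<in>P. y B)) powr (t - 1)) \<partial>PiM P (\<lambda>_. lborel))"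
    unfolding s_def
    by (intro nn_integral_cong block_density_times_powers P t) (auto simp: space_PiM PiE_def)
  also have "\<dots> = ennreal (t ^ card P) * (\<integral>\<^sup>+y. ennreal ((\<Prod>B\<in>P. indicator {0..} (y B) * y B ^ s B) *
      max 0 (1 - (\<Sum>B\<in>P. y B)) powr (t - 1)) \<partial>PiM P (\<lambda>_. lborel))"
    by (intro nn_integral_cmult) measurable
  \<comment> \<open>Dirichlet's integral with b = t and c = 1, where the remaining power of c is
    1.\<close>
  also have "\<dots> = ennreal (t ^ card P) *
      ennreal ((\<Prod>B\<in>P. fact (s B)) / pochhammer t (\<Sum>B\<in>P. Suc (s B)))"
    by (subst nn_integral_dirichlet[OF finP t]) simp
  also have "\<dots> = ennreal (t ^ card P * (\<Prod>B\<in>P. fact (s B)) / pochhammer t (\<Sum>i\<in>{0..<n}. Suc (k i)))"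
    using t unfolding total by (subst ennreal_mult'[symmetric]) auto
  finally show ?thesis by (simp add: s_def)
qed

section \<open>Comparison of the controlling measure with the sum of the block measures\<close>

theorem theorem7p1:
  fixes t :: real and n :: nat and PD :: "(nat \<Rightarrow> real) measure"
  assumes t_pos: "0 < t"
    and n_pos: "1 \<le> n"
    and PD_prob: "prob_space PD"
    and PD_sets: "sets PD = sets (restrict_space borel Delta)"
    and PD_moments: "\<And>lam. is_partition lam \<Longrightarrow>
                       (\<integral>\<alpha>. mtilde lam \<alpha> \<partial>PD) = M_t t lam / dim0 lam"
  shows "\<forall>A \<in> sets (PiM {0..<n} (\<lambda>_. borel :: real measure)).
           emeasure (controlling_measure PD n) A =
           (\<Sum>r = 1..n. \<Sum>P \<in> set_partitions n r. emeasure (sigma_block t n P) A)"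
proof
  fix A assume A: "A \<in> sets (PiM {0..<n} (\<lambda>_. borel :: real measure))"
  define Q where "Q = {P. partition_on {0..<n} P}"
  define D where "D = (\<lambda>k P. t ^ card P * (\<Prod>B\<in>P. fact ((\<Sum>i\<in>B. Suc (k i)) - 1)) /
      pochhammer t (\<Sum>i\<in>{0..<n}. Suc (k i)))"
  define \<mu> where "\<mu> = controlling_measure PD n"
  \<comment> \<open>The finite sum of the block measures, written as a bind over the counting
    measure. This form requires each block measure to be a subprobability.\<close>
  define \<nu> where "\<nu> = count_space Q \<bind> sigma_block t n"
  have finQ: "finite Q" unfolding Q_def by (rule finitely_many_partition_on) simp
  \<comment> \<open>On an empty space \<open>bind\<close> would only return a default value.\<close>
  have neQ: "Q \<noteq> {}" unfolding Q_def using partition_on_singletons by blast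
  have D0: "0 \<le> D k P" for k P
    using t_pos unfolding D_def by (intro divide_nonneg_nonneg mult_nonneg_nonneg prod_nonneg)
      (auto intro: pochhammer_nonneg)
  have \<mu>_moments: "(\<integral>\<^sup>+x. (\<Prod>i\<in>{0..<n}. ennreal (x i ^ k i)) \<partial>\<mu>) = ennreal (\<Sum>P\<in>Q. D k P)" for k
    unfolding \<mu>_def nn_integral_controlling_measure[OF PD_prob PD_sets] Q_def D_def
    by (subst integral_prod_ptilde[OF PD_prob PD_sets PD_moments]) auto
  interpret \<mu>: prob_space \<mu>
    unfolding \<mu>_def by (rule prob_space_controlling_measure[OF PD_prob PD_sets])
  have block_moments: "(\<integral>\<^sup>+x. (\<Prod>i\<in>{0..<n}. ennreal (x i ^ k i)) \<partial>sigma_block t n P) = ennreal (D k P)"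
    if "P \<in> Q" for k P
    using nn_integral_sigma_block[OF _ t_pos] that by (simp add: Q_def D_def)
  \<comment> \<open>\<open>D (\<lambda>_. 0) P\<close> is the total mass of the block measure of
    \<open>P\<close>, and equals t^r \<Prod>(|B| - 1)! / (t)_n, the Ewens probability of the set
    partition. That these add up to 1 follows from the zeroth moment of the probability measure
    \<mu>.\<close>
  have "(\<Sum>P\<in>Q. D (\<lambda>_. 0) P) = 1"
    using \<mu>_moments[of "\<lambda>_. 0"] D0 by (simp add: \<mu>.emeasure_space_1 sum_nonneg)
  then have D1: "D (\<lambda>_. 0) P \<le> 1" if "P \<in> Q" for P
    using member_le_sum[of P Q "D (\<lambda>_. 0)"] D0 finQ that by simp
  have kernel: "sigma_block t n \<in> count_space Q \<rightarrow>\<^sub>M subprob_algebra (PiM {0..<n} (\<lambda>_. borel))"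
  proof -
    have "subprob_space (sigma_block t n P)" if P: "P \<in> Q" for P
    proof (rule subprob_spaceI)
      have "emeasure (sigma_block t n P) (space (sigma_block t n P)) = ennreal (D (\<lambda>_. 0) P)"
        using block_moments[OF P, of "\<lambda>_. 0"] by simp
      also have "\<dots> \<le> 1" using D1[OF P] by simp
      finally show "emeasure (sigma_block t n P) (space (sigma_block t n P)) \<le> 1" .
      show "space (sigma_block t n P) \<noteq> {}"
        by (auto simp: sigma_block_def space_PiM PiE_eq_empty_iff)
    qed
    then show ?thesis by (simp add: space_subprob_algebra)
  qed
  have \<nu>_moments: "(\<integral>\<^sup>+x. (\<Prod>i\<in>{0..<n}. ennreal (x i ^ k i)) \<partial>\<nu>) = ennreal (\<Sum>P\<in>Q. D k P)" for k
  proof -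
    have "(\<integral>\<^sup>+x. (\<Prod>i\<in>{0..<n}. ennreal (x i ^ k i)) \<partial>\<nu>) =
        (\<Sum>P\<in>Q. \<integral>\<^sup>+x. (\<Prod>i\<in>{0..<n}. ennreal (x i ^ k i)) \<partial>sigma_block t n P)"
      unfolding \<nu>_def using finQ
      by (subst nn_integral_bind[OF _ kernel]) (auto simp: nn_integral_count_space_finite)
    then show ?thesis using D0 by (simp add: block_moments sum_ennreal)
  qed
  have "\<mu> = \<nu>"
  proof (rule measure_eqI_moments_unit_cube)
    show "sets \<mu> = sets (PiM {0..<n} (\<lambda>_. borel))"
      unfolding \<mu>_def by (rule sets_controlling_measure[OF PD_prob PD_sets])
    show "sets \<nu> = sets (PiM {0..<n} (\<lambda>_. borel))"
      unfolding \<nu>_def using neQ by (intro sets_bind) auto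
    show "AE x in \<mu>. x i \<in> {0..1}" if "i \<in> {0..<n}" for i
      using that unfolding \<mu>_def by (intro AE_controlling_measure[OF PD_prob PD_sets]) simp
    show "AE x in \<nu>. x i \<in> {0..1}" if i: "i \<in> {0..<n}" for i
    proof -
      have [measurable]: "(\<lambda>x. x i) \<in> borel_measurable (PiM {0..<n} (\<lambda>_. borel :: real measure))"
        using i by (rule measurable_component_singleton)
      have "Measurable.pred (PiM {0..<n} (\<lambda>_. borel)) (\<lambda>x. x i \<in> {0..1::real})" by measurable
      moreover have "AE P in count_space Q. AE x in sigma_block t n P. x i \<in> {0..1}"
        using i AE_sigma_block by (simp only: AE_count_space Q_def) simp
      ultimately show ?thesis
        unfolding \<nu>_def by (simp only: AE_bind[OF kernel])
    qed
    show "finite_measure \<mu>" by (rule \<mu>.finite_measure_axioms)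
    show "finite_measure \<nu>"
    proof
      show "emeasure \<nu> (space \<nu>) \<noteq> \<infinity>" using \<nu>_moments[of "\<lambda>_. 0"] by simp
    qed
  qed (simp_all add: \<mu>_moments \<nu>_moments)
  then have "emeasure (controlling_measure PD n) A = (\<Sum>P\<in>Q. emeasure (sigma_block t n P) A)"
    using emeasure_bind[OF _ kernel A] neQ finQ
    by (simp add: \<mu>_def \<nu>_def nn_integral_count_space_finite)
  also have "\<dots> = (\<Sum>r = 1..n. \<Sum>P | P \<in> Q \<and> card P = r. emeasure (sigma_block t n P) A)"
  proof (rule sum.group[symmetric, OF finQ])
    \<comment> \<open>Nonempty disjoint blocks number at most n, and \<open>n_pos\<close> excludes
      the partition without blocks.\<close>
    show "card ` Q \<subseteq> {1..n}"
    proof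
      fix r assume "r \<in> card ` Q"
      then obtain P where P: "partition_on {0..<n} P" and r: "r = card P" by (auto simp: Q_def)
      have "finite P" using P by (rule finite_elements[rotated]) simp
      moreover have "P \<noteq> {}" using P n_pos by (auto simp: partition_on_def)
      moreover have "card P \<le> card (\<Union>P)"
      proof -
        have "finite B \<and> B \<noteq> {}" if "B \<in> P" for B
          using P that by (auto simp: partition_on_def intro: finite_subset[of B "{0..<n}"])
        then have "(\<Sum>B\<in>P. 1) \<le> (\<Sum>B\<in>P. card B)"
          by (intro sum_mono) (simp add: Suc_le_eq card_gt_0_iff)
        also have "\<dots> = card (\<Union>P)"
          using P by (intro card_Union_disjoint[symmetric])
            (auto simp: partition_on_def intro: finite_subset[of _ "{0..<n}"])
        finally show ?thesis by simp
      qed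
      ultimately show "r \<in> {1..n}" using P by (simp add: r Suc_le_eq card_gt_0_iff partition_on_def)
    qed
  qed simp
  finally show "emeasure (controlling_measure PD n) A =
      (\<Sum>r = 1..n. \<Sum>P \<in> set_partitions n r. emeasure (sigma_block t n P) A)"
    by (simp add: Q_def set_partitions_def)
qed

end
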